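(* Let $m\in\mathbb{N}=\{1,2,3,\dots\}$, and let $\mathscr{B}$ be a Banach algebra (with pointwise operations and norm $\|\cdot\|_{\mathscr{B}}$) such that (1) $\mathscr{P}\subset\mathscr{B}\subset\mathscr{H}^\infty$; (2) there exists $C>0$ such that $\|f\|_\infty\le C\|f\|_{\mathscr{B}}$ for all $f\in\mathscr{B}$; (3) $\mathscr{B}$ has the Wiener property: for all $f\in\mathscr{B}$ satisfying $\inf_{s\in\mathbb{C}_+}|f(s)|>0$, we have $\frac1f\in\mathscr{B}$. Then $(\partial^{-m}\mathscr{B})^{-1}=e^{\partial^{-m}\mathscr{B}}$, that is, the group of invertible elements of $\partial^{-m}\mathscr{B}$ is equal to $\{e^f: f\in\partial^{-m}\mathscr{B}\}$.
   Context: $\mathbb{C}_+=\{s\in\mathbb{C}:\mathrm{Re}(s)>0\}$. $\mathscr{H}^\infty$ is the set of all Dirichlet series $f(s)=\sum_{n=1}^\infty \frac{a_n}{n^s}$ ($a_n\in\mathbb{C}$) that converge at every $s\in\mathbb{C}_+$ and satisfy $\|f\|_\infty:=\sup_{s\in\mathbb{C}_+}|f(s)|<\infty$; it is a Banach algebra with pointwise operations and the norm $\|\cdot\|_\infty$. $\mathscr{P}\subset\mathscr{H}^\infty$ is the set of Dirichlet polynomials, i.e. Dirichlet series $\sum_{n=1}^N\frac{a_n}{n^s}$ with $N\in\mathbb{N}$, $a_1,\dots,a_N\in\mathbb{C}$. For $m\in\mathbb{N}$, $\partial^{-m}\mathscr{B}$ denotes the Banach algebra of all $f\in\mathscr{B}$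 such that $f',\dots,f^{(m)}\in\mathscr{B}$ (derivatives with respect to $s\in\mathbb{C}_+$), with pointwise operations and the norm $\|f\|_{\partial^{-m}\mathscr{B}}=\sum_{\ell=0}^m\frac{1}{\ell!}\|f^{(\ell)}\|_{\mathscr{B}}$. For a unital commutative complex Banach algebra $A$, $A^{-1}$ denotes the multiplicative group of invertible elements of $A$, and $e^A=\{e^a:a\in A\}$. *)

theory Defs
  imports "HOL-Analysis.Analysis"
begin

typedef right_half_plane = "{s::complex. Re s > 0}"
  morphisms point_of right_half_plane_of
  by (rule exI[of _ 1]) simp

text \<open>No unit is required, and if there is one its norm need not be 1.\<close>

locale pointwise_banach_algebra =
  fixes A :: "('x \<Rightarrow> complex) set" and nrm :: "('x \<Rightarrow> complex) \<Rightarrow> real"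
  assumes zero_closed: "(\<lambda>s. 0) \<in> A"
    and add_closed: "f \<in> A \<Longrightarrow> g \<in> A \<Longrightarrow> (\<lambda>s. f s + g s) \<in> A"
    and scale_closed: "f \<in> A \<Longrightarrow> (\<lambda>s. c * f s) \<in> A"
    and mult_closed: "f \<in> A \<Longrightarrow> g \<in> A \<Longrightarrow> (\<lambda>s. f s * g s) \<in> A"
    and norm_nonneg: "f \<in> A \<Longrightarrow> 0 \<le> nrm f"
    and norm_eq_0_iff: "f \<in> A \<Longrightarrow> nrm f = 0 \<longleftrightarrow> f = (\<lambda>s. 0)"
    and norm_scale: "f \<in> A \<Longrightarrow> nrm (\<lambda>s. c * f s) = cmod c * nrm f"
    and norm_triangle: "f \<in> A \<Longrightarrow> g \<in> A \<Longrightarrow> nrm (\<lambda>s. f s + g s) \<le> nrm f + nrm g"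
    and norm_submult: "f \<in> A \<Longrightarrow> g \<in> A \<Longrightarrow> nrm (\<lambda>s. f s * g s) \<le> nrm f * nrm g"
    and norm_complete:
      "(\<forall>n. X n \<in> A) \<Longrightarrow>
       (\<forall>e>0. \<exists>M. \<forall>i\<ge>M. \<forall>j\<ge>M. nrm (\<lambda>s. X i s - X j s) < e) \<Longrightarrow>
       \<exists>l\<in>A. (\<lambda>n::nat. nrm (\<lambda>s. X n s - l s)) \<longlonglongrightarrow> 0"

definition invertibles :: "('x \<Rightarrow> complex) set \<Rightarrow> ('x \<Rightarrow> complex) set" where
  "invertibles A = {f \<in> A. \<exists>g\<in>A. \<forall>s. f s * g s = 1}"

text \<open>The exponential of the Banach algebra: the sum of the exponential series in the
  norm of the algebra, not just pointwise.\<close>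

definition algebra_exp ::
  "('x \<Rightarrow> complex) set \<Rightarrow> (('x \<Rightarrow> complex) \<Rightarrow> real) \<Rightarrow> ('x \<Rightarrow> complex) \<Rightarrow> ('x \<Rightarrow> complex)" where
  "algebra_exp A nrm a =
     (THE b. b \<in> A \<and> (\<lambda>n. nrm (\<lambda>s. (\<Sum>k<n. a s ^ k / fact k) - b s)) \<longlonglongrightarrow> 0)"

definition Hinf :: "(right_half_plane \<Rightarrow> complex) set" where
  "Hinf = {f. (\<exists>a :: nat \<Rightarrow> complex. \<forall>s.
                 (\<lambda>n. a (Suc n) / of_nat (Suc n) powr point_of s) sums f s)
              \<and> bounded (range f)}"

definition Hinf_norm :: "(right_half_plane \<Rightarrow> complex) \<Rightarrow> real" where
  "Hinf_norm f = (SUP s. cmod (f s))"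

definition dirichlet_polys :: "(right_half_plane \<Rightarrow> complex) set" where
  "dirichlet_polys =
     {f. \<exists>(N::nat) (a :: nat \<Rightarrow> complex). N \<ge> 1 \<and>
           f = (\<lambda>s. \<Sum>n=1..N. a n / of_nat n powr point_of s)}"

definition wiener_property :: "(right_half_plane \<Rightarrow> complex) set \<Rightarrow> bool" where
  "wiener_property B \<longleftrightarrow> (\<forall>f\<in>B. (INF s. cmod (f s)) > 0 \<longrightarrow> (\<lambda>s. 1 / f s) \<in> B)"

text \<open>The values of \<^const>\<open>right_half_plane_of\<close> off the (open) half-plane do not
  affect the derivative.\<close>

definition hp_deriv :: "(right_half_plane \<Rightarrow> complex) \<Rightarrow> (right_half_plane \<Rightarrow> complex)" where
  "hp_deriv f = (\<lambda>s. deriv (\<lambda>z. f (right_half_plane_of z)) (point_of s))"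

text \<open>In the next two definitions \<^const>\<open>hp_deriv\<close> is only meaningful on differentiable
  functions; elements of \<^const>\<open>Hinf\<close> are holomorphic.\<close>

definition deriv_algebra ::
  "nat \<Rightarrow> (right_half_plane \<Rightarrow> complex) set \<Rightarrow> (right_half_plane \<Rightarrow> complex) set" where
  "deriv_algebra m B = {f \<in> B. \<forall>l\<in>{1..m}. (hp_deriv ^^ l) f \<in> B}"

definition deriv_norm ::
  "nat \<Rightarrow> ((right_half_plane \<Rightarrow> complex) \<Rightarrow> real) \<Rightarrow> (right_half_plane \<Rightarrow> complex) \<Rightarrow> real" where
  "deriv_norm m nrm f = (\<Sum>l=0..m. 1 / fact l * nrm ((hp_deriv ^^ l) f))"

end

theory Submission
  imports Defs "HOL-Complex_Analysis.Complex_Analysis" "HOL-Probability.Probability" "HOL-Real_Asymp.Real_Asymp"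
begin

text \<open>If \<open>f\<close> and \<open>f'\<close> lie in \<open>B\<close>, then \<open>f\<close> has bounded derivative, so it is uniformly close to its
  averages over small Gaussian vertical translations. These have absolutely convergent Dirichlet series
  up to the boundary, hence \<open>f\<close> is a uniform limit of Dirichlet polynomials \<open>p\<close>. If moreover
  \<open>\<bar>f\<bar>\<close> is bounded below, the Wiener property makes the segment from \<open>p\<close> to \<open>f\<close> and the path of
  translates \<open>p(s + \<sigma>)\<close>, \<open>0 \<le> \<sigma> \<le> \<infinity>\<close>, consist of invertible elements of \<open>B\<close>. The latter ends at
  a nonzero constant, so \<open>f\<close> lies in the component of the identity and \<open>f = e\<^sup>h\<close> with \<open>h \<in> B\<close>. Finally
  \<open>h' = f' / f\<close> puts \<open>h\<close> in the algebra of differentiable elements.\<close>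

section \<open>Logarithms in algebras whose norm dominates the supremum norm\<close>

locale sup_dominating_algebra = pointwise_banach_algebra A nrm
  for A :: "('x \<Rightarrow> complex) set" and nrm +
  fixes C :: real
  assumes C_ge_1: "C \<ge> 1"
    and eval_bound: "f \<in> A \<Longrightarrow> cmod (f s) \<le> C * nrm f"
    and one_closed: "(\<lambda>s. 1) \<in> A"
begin

lemma const_closed: "(\<lambda>s. c) \<in> A"
  using scale_closed[OF one_closed, of c] by simp

lemma uminus_closed: "f \<in> A \<Longrightarrow> (\<lambda>s. - f s) \<in> A"
  using scale_closed[of f "-1"] by simp

lemma diff_closed: "f \<in> A \<Longrightarrow> g \<in> A \<Longrightarrow> (\<lambda>s. f s - g s) \<in> A"
  using add_closed[OF _ uminus_closed] by fastforce

lemma norm_uminus: "f \<in> A \<Longrightarrow> nrm (\<lambda>s. - f s) = nrm f"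
  using norm_scale[of f "-1"] by simp

lemma norm_zero: "nrm (\<lambda>s. 0) = 0"
  using norm_eq_0_iff[OF zero_closed] by simp

lemma sum_closed: "(\<And>i. i \<in> I \<Longrightarrow> F i \<in> A) \<Longrightarrow> (\<lambda>s. \<Sum>i\<in>I. F i s) \<in> A"
  by (induction I rule: infinite_finite_induct) (auto simp: zero_closed add_closed)

lemma norm_sum_le:
  "(\<And>i. i \<in> I \<Longrightarrow> F i \<in> A) \<Longrightarrow> nrm (\<lambda>s. \<Sum>i\<in>I. F i s) \<le> (\<Sum>i\<in>I. nrm (F i))"
proof (induction I rule: infinite_finite_induct)
  case (insert x I)
  have "nrm (\<lambda>s. F x s + (\<Sum>i\<in>I. F i s)) \<le> nrm (F x) + nrm (\<lambda>s. \<Sum>i\<in>I. F i s)"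
    using insert by (intro norm_triangle sum_closed) auto
  with insert show ?case by force
qed (auto simp: norm_zero)

lemma power_closed: "f \<in> A \<Longrightarrow> (\<lambda>s. f s ^ k) \<in> A"
  by (induction k) (auto simp: one_closed mult_closed)

lemma norm_power_le: "f \<in> A \<Longrightarrow> nrm (\<lambda>s. f s ^ k) \<le> nrm (\<lambda>s. 1) * nrm f ^ k"
proof (induction k)
  case (Suc k)
  have "nrm (\<lambda>s. f s * f s ^ k) \<le> nrm f * nrm (\<lambda>s. f s ^ k)"
    using Suc.prems by (intro norm_submult power_closed)
  also have "\<dots> \<le> nrm f * (nrm (\<lambda>s. 1) * nrm f ^ k)"
    using Suc by (intro mult_left_mono norm_nonneg) auto
  finally show ?case by (simp add: mult_ac)
qed auto

section \<open>Norm limits, absolutely convergent series, exponential and logarithm\<close>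

lemma tendsto_eval:
  assumes "\<And>n. X n \<in> A" "l \<in> A" "(\<lambda>n. nrm (\<lambda>s. X n s - l s)) \<longlonglongrightarrow> 0"
  shows "(\<lambda>n. X n s) \<longlonglongrightarrow> l s"
proof -
  have "(\<lambda>n. C * nrm (\<lambda>s. X n s - l s)) \<longlonglongrightarrow> 0"
    using tendsto_mult_right_zero[OF assms(3)] by simp
  then have "(\<lambda>n. X n s - l s) \<longlonglongrightarrow> 0"
    by (rule Lim_null_comparison[rotated])
       (intro always_eventually allI eval_bound diff_closed assms)
  then show ?thesis by (simp add: LIM_zero_iff)
qed

text \<open>Increments of the partial sums are dominated by increments of the series of norms, so
  completeness applies. The last conclusion lets the limit be recognised from its values.\<close>

lemma abs_summable_imp_sums:
  assumes X: "\<And>n. X n \<in> A" and sm: "summable (\<lambda>n. nrm (X n))"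
  obtains l where "l \<in> A" "(\<lambda>n. nrm (\<lambda>s. (\<Sum>k<n. X k s) - l s)) \<longlonglongrightarrow> 0"
    "\<And>s. (\<lambda>n. X n s) sums l s"
proof -
  define S where "S = (\<lambda>n s. \<Sum>k<n. X k s)"
  have SA: "S n \<in> A" for n
    unfolding S_def by (intro sum_closed X)
  have diff: "nrm (\<lambda>s. S i s - S j s) \<le> \<bar>(\<Sum>k<i. nrm (X k)) - (\<Sum>k<j. nrm (X k))\<bar>" for i j
  proof -
    have *: "nrm (\<lambda>s. S i s - S j s) \<le> (\<Sum>k<i. nrm (X k)) - (\<Sum>k<j. nrm (X k))" if "j \<le> i" for i j
    proof -
      have split: "(\<Sum>k<i. F k) - (\<Sum>k<j. F k) = (\<Sum>k\<in>{j..<i}. F k)" for F :: "nat \<Rightarrow> 'c::ab_group_add"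
        using sum_diff_nat_ivl[of 0 j i F] that by (simp add: atLeast0LessThan)
      show ?thesis
        unfolding S_def split by (intro norm_sum_le X)
    qed
    show ?thesis
    proof (cases "j \<le> i")
      case True
      then show ?thesis using *[OF True] by linarith
    next
      case False
      have "nrm (\<lambda>s. S i s - S j s) = nrm (\<lambda>s. S j s - S i s)"
        using norm_uminus[OF diff_closed[OF SA SA], of j i] by simp
      with *[of i j] False show ?thesis by linarith
    qed
  qed
  have "Cauchy (\<lambda>n. \<Sum>k<n. nrm (X k))"
    using sm by (intro convergent_Cauchy) (simp add: summable_iff_convergent)
  have "\<exists>l\<in>A. (\<lambda>n. nrm (\<lambda>s. S n s - l s)) \<longlonglongrightarrow> 0"
  proof (rule norm_complete)
    show "\<forall>e>0. \<exists>M. \<forall>i\<ge>M. \<forall>j\<ge>M. nrm (\<lambda>s. S i s - S j s) < e"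
    proof (intro allI impI)
      fix e :: real assume "e > 0"
      with \<open>Cauchy _\<close> obtain M where
        "\<forall>i\<ge>M. \<forall>j\<ge>M. dist (\<Sum>k<i. nrm (X k)) (\<Sum>k<j. nrm (X k)) < e"
        by (auto simp: Cauchy_def)
      then show "\<exists>M. \<forall>i\<ge>M. \<forall>j\<ge>M. nrm (\<lambda>s. S i s - S j s) < e"
        using diff unfolding dist_real_def by (meson order.strict_trans1)
    qed
  qed (use SA in auto)
  then obtain l where l: "l \<in> A" "(\<lambda>n. nrm (\<lambda>s. S n s - l s)) \<longlonglongrightarrow> 0" by blast
  from tendsto_eval[OF SA l] have "(\<lambda>n. X n s) sums l s" for s
    by (simp add: S_def sums_def)
  with l show ?thesis by (intro that[of l]) (auto simp: S_def)
qed

text \<open>The terms are at most \<open>nrm (\<lambda>s. 1) * nrm a ^ k / fact k\<close>; the first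
  factor is there because the unit may have a norm other than 1. Evaluation at each point then
  identifies the sum.\<close>

lemma exp_series_limit:
  assumes a: "a \<in> A"
  shows "(\<lambda>s. exp (a s)) \<in> A"
    and "(\<lambda>n. nrm (\<lambda>s. (\<Sum>k<n. a s ^ k / fact k) - exp (a s))) \<longlonglongrightarrow> 0"
proof -
  define X where "X = (\<lambda>k s. a s ^ k / fact k)"
  have X_eq: "X k = (\<lambda>s. (1 / fact k) * a s ^ k)" for k
    by (simp add: X_def)
  have XA: "X k \<in> A" for k
    unfolding X_eq by (intro scale_closed power_closed a)
  have bound: "nrm (X k) \<le> nrm (\<lambda>s. 1) * (nrm a ^ k / fact k)" for k
    unfolding X_eq using norm_power_le[OF a, of k]
    by (subst norm_scale[OF power_closed[OF a]]) (simp add: norm_divide divide_right_mono)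
  have "summable (\<lambda>k. nrm (\<lambda>s. 1) * (nrm a ^ k / fact k))"
    by (intro summable_mult) (use summable_exp[of "nrm a"] in \<open>simp add: divide_inverse mult.commute\<close>)
  then have "summable (\<lambda>k. nrm (X k))"
    by (rule summable_comparison_test'[where N = 0]) (metis bound norm_nonneg[OF XA] real_norm_def abs_of_nonneg)
  from abs_summable_imp_sums[OF XA this] obtain l where
    l: "l \<in> A" "(\<lambda>n. nrm (\<lambda>s. (\<Sum>k<n. X k s) - l s)) \<longlonglongrightarrow> 0" "\<And>s. (\<lambda>n. X n s) sums l s"
    by blast
  have "l s = exp (a s)" for s
  proof (rule sums_unique2[OF l(3)])
    show "(\<lambda>k. X k s) sums exp (a s)"
      using exp_converges[of "a s"]
      by (simp add: X_def scaleR_conv_of_real divide_inverse mult.commute)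
  qed
  then have "l = (\<lambda>s. exp (a s))" by blast
  with l show "(\<lambda>s. exp (a s)) \<in> A"
    "(\<lambda>n. nrm (\<lambda>s. (\<Sum>k<n. a s ^ k / fact k) - exp (a s))) \<longlonglongrightarrow> 0"
    by (auto simp: X_def)
qed

text \<open>The definite description is well defined: by \<open>tendsto_eval\<close> a norm limit is
  determined by its values.\<close>

lemma algebra_exp_eq:
  assumes a: "a \<in> A"
  shows "algebra_exp A nrm a = (\<lambda>s. exp (a s))"
  unfolding algebra_exp_def
proof (rule the_equality)
  show "(\<lambda>s. exp (a s)) \<in> A \<and>
      (\<lambda>n. nrm (\<lambda>s. (\<Sum>k<n. a s ^ k / fact k) - exp (a s))) \<longlonglongrightarrow> 0"
    using exp_series_limit[OF a] by blast
next
  have SA: "(\<lambda>s. \<Sum>k<n. a s ^ k / fact k) \<in> A" for n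
    using scale_closed[OF power_closed[OF a], of "1 / fact _"] by (intro sum_closed) simp
  fix b assume b: "b \<in> A \<and> (\<lambda>n. nrm (\<lambda>s. (\<Sum>k<n. a s ^ k / fact k) - b s)) \<longlonglongrightarrow> 0"
  have "b s = exp (a s)" for s
  proof (rule LIMSEQ_unique)
    show "(\<lambda>n. \<Sum>k<n. a s ^ k / fact k) \<longlonglongrightarrow> b s"
      by (rule tendsto_eval[where X = "\<lambda>n s. \<Sum>k<n. a s ^ k / fact k"]) (use SA b in auto)
    show "(\<lambda>n. \<Sum>k<n. a s ^ k / fact k) \<longlonglongrightarrow> exp (a s)"
      by (rule tendsto_eval[where X = "\<lambda>n s. \<Sum>k<n. a s ^ k / fact k"])
         (use SA exp_series_limit[OF a] in auto)
  qed
  then show "b = (\<lambda>s. exp (a s))" by blast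
qed

text \<open>The logarithm series converges in norm because \<open>nrm v < 1\<close> and has the
  right value at each point because \<open>cmod (v s) < 1\<close>; \<open>small\<close> yields both,
  through \<open>C_ge_1\<close> and \<open>eval_bound\<close>.\<close>

lemma ex_log_near_one:
  assumes v: "v \<in> A" and small: "C * nrm v < 1"
  shows "\<exists>h\<in>A. \<forall>s. exp (h s) = 1 + v s"
proof -
  have nv: "nrm v \<ge> 0" by (rule norm_nonneg[OF v])
  have "nrm v \<le> C * nrm v"
    using mult_right_mono[OF C_ge_1 nv] by simp
  then have nv1: "nrm v < 1" using small by linarith
  \<comment> \<open>The term for \<open>k = 0\<close> is a division by zero, hence 0, as the
    logarithm series requires.\<close>
  define X where "X = (\<lambda>k s. - ((- v s) ^ k) / of_nat k)"
  have X_eq: "X k = (\<lambda>s. (- ((-1) ^ k) / of_nat k) * v s ^ k)" for k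
    unfolding X_def by (subst power_minus) simp
  have XA: "X k \<in> A" for k
    unfolding X_eq by (intro scale_closed power_closed v)
  have bound: "nrm (X k) \<le> nrm (\<lambda>s. 1) * nrm v ^ k" for k
  proof -
    have "nrm (X k) = cmod (- ((-1) ^ k) / of_nat k) * nrm (\<lambda>s. v s ^ k)"
      unfolding X_eq by (rule norm_scale[OF power_closed[OF v]])
    also have "\<dots> \<le> 1 * nrm (\<lambda>s. v s ^ k)"
      by (intro mult_right_mono norm_nonneg power_closed v)
         (auto simp: norm_divide norm_power divide_simps)
    finally show ?thesis using norm_power_le[OF v, of k] by simp
  qed
  have "summable (\<lambda>k. nrm (\<lambda>s. 1) * nrm v ^ k)"
    using nv nv1 by (intro summable_mult summable_geometric) auto
  then have "summable (\<lambda>k. nrm (X k))"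
    by (rule summable_comparison_test'[where N = 0]) (metis bound norm_nonneg[OF XA] real_norm_def abs_of_nonneg)
  from abs_summable_imp_sums[OF XA this] obtain l where
    l: "l \<in> A" "\<And>s. (\<lambda>n. X n s) sums l s"
    by blast
  have "exp (l s) = 1 + v s" for s
  proof -
    have lt: "cmod (v s) < 1" using eval_bound[OF v, of s] small by linarith
    have "(\<lambda>k. X k s) sums Ln (1 + v s)"
      unfolding X_def by (rule Ln_series'[OF lt])
    with l(2)[of s] have "l s = Ln (1 + v s)" by (rule sums_unique2)
    moreover have "1 + v s \<noteq> 0"
      using lt by (metis add.inverse_unique less_irrefl norm_minus_cancel norm_one)
    ultimately show ?thesis by simp
  qed
  with l show ?thesis by blast
qed

section \<open>Exponentials along continuous paths of invertible elements\<close>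

definition exponentials :: "('x \<Rightarrow> complex) set" where
  "exponentials = {f. \<exists>h\<in>A. \<forall>s. f s = exp (h s)}"

text \<open>The exponentials form an open subgroup of the invertible elements, and so a union of
  connected components.\<close>

lemma exponentials_path:
  fixes P :: "real \<Rightarrow> 'x \<Rightarrow> complex"
  assumes P: "\<And>t. t \<in> {0..1} \<Longrightarrow> P t \<in> A"
    and inv: "\<And>t. t \<in> {0..1} \<Longrightarrow> \<exists>q\<in>A. \<forall>s. P t s * q s = 1"
    and cont: "\<And>t. t \<in> {0..1} \<Longrightarrow> ((\<lambda>u. nrm (\<lambda>s. P u s - P t s)) \<longlongrightarrow> 0) (at t within {0..1})"
    and "P 0 \<in> exponentials"
  shows "P 1 \<in> exponentials"
proof (rule connected_induction_simple[where S = "{0..1}" and P = "\<lambda>t. P t \<in> exponentials"])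
  fix t :: real assume t: "t \<in> {0..1}"
  obtain q where q: "q \<in> A" "\<And>s. P t s * q s = 1" using inv[OF t] by blast
  have "((\<lambda>u. C * (nrm (\<lambda>s. P u s - P t s) * nrm q)) \<longlongrightarrow> C * (0 * nrm q)) (at t within {0..1})"
    by (intro tendsto_intros cont t)
  then have "\<forall>\<^sub>F u in at t within {0..1}. C * (nrm (\<lambda>s. P u s - P t s) * nrm q) < 1"
    by (auto elim!: order_tendstoD)
  then obtain d where d: "d > 0"
    "\<And>u. u \<in> {0..1} \<Longrightarrow> u \<noteq> t \<Longrightarrow> dist u t < d \<Longrightarrow> C * (nrm (\<lambda>s. P u s - P t s) * nrm q) < 1"
    by (auto simp: eventually_at)
  define T where "T = {0..1} \<inter> ball t d"
  \<comment> \<open>Near \<open>t\<close> membership changes in neither direction: along the path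
    both the exponentials and their complement are open.\<close>
  have near: "P u \<in> exponentials \<longleftrightarrow> P t \<in> exponentials" if u: "u \<in> T" for u
  proof -
    have u': "u \<in> {0..1}" "dist u t < d" using u by (auto simp: T_def dist_commute)
    have less: "C * (nrm (\<lambda>s. P u s - P t s) * nrm q) < 1"
      using d(2)[of u] u' by (cases "u = t") (auto simp: norm_zero)
    \<comment> \<open>As \<open>q\<close> is the inverse of \<open>P t\<close>, this is
      \<open>P u / P t - 1\<close>; the choice of \<open>d\<close> makes it small enough for
      \<open>P u / P t\<close> to have a logarithm.\<close>
    define v where "v = (\<lambda>s. (P u s - P t s) * q s)"
    have v: "v \<in> A" unfolding v_def by (intro mult_closed diff_closed P t u' q)
    have "nrm v \<le> nrm (\<lambda>s. P u s - P t s) * nrm q"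
      unfolding v_def by (intro norm_submult diff_closed P t u' q)
    then have "C * nrm v \<le> C * (nrm (\<lambda>s. P u s - P t s) * nrm q)"
      using C_ge_1 by (intro mult_left_mono) auto
    with less have "C * nrm v < 1" by linarith
    from ex_log_near_one[OF v this] obtain h where h: "h \<in> A" "\<And>s. exp (h s) = 1 + v s" by blast
    have ut: "P u s = P t s * exp (h s)" for s
    proof -
      have "P t s * exp (h s) = P t s + (P u s - P t s) * (P t s * q s)"
        by (simp add: h v_def algebra_simps)
      then show ?thesis by (simp add: q)
    qed
    show ?thesis
    proof
      assume "P u \<in> exponentials"
      then obtain g where g: "g \<in> A" "\<And>s. P u s = exp (g s)" by (auto simp: exponentials_def)
      have "P t s = exp (g s - h s)" for s
        using ut[of s] by (simp add: g exp_diff)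
      then show "P t \<in> exponentials"
        using diff_closed[OF g(1) h(1)] by (auto simp: exponentials_def)
    next
      assume "P t \<in> exponentials"
      then obtain g where g: "g \<in> A" "\<And>s. P t s = exp (g s)" by (auto simp: exponentials_def)
      have "P u s = exp (g s + h s)" for s
        using ut[of s] by (simp add: g exp_add)
      then show "P u \<in> exponentials"
        using add_closed[OF g(1) h(1)] by (auto simp: exponentials_def)
    qed
  qed
  show "\<exists>T. openin (top_of_set {0..1}) T \<and> t \<in> T \<and>
          (\<forall>x\<in>T. \<forall>y\<in>T. P x \<in> exponentials \<longrightarrow> P y \<in> exponentials)"
  proof (intro exI[of _ T] conjI ballI impI)
    show "openin (top_of_set {0..1}) T"
      unfolding T_def by (rule openin_open_Int) (rule open_ball)
    show "t \<in> T" using t d(1) by (simp add: T_def)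
  qed (use near in blast)
qed (use assms(4) in auto)

end

section \<open>Dirichlet series on the right half-plane\<close>

text \<open>The difference is the integral of \<open>w * exp (- (w * x))\<close> from
  \<open>u\<close> to \<open>v\<close>; its modulus is at most the integral of the modulus, which is
  elementary.\<close>

lemma norm_exp_diff_le:
  fixes w :: complex and u v :: real
  assumes "Re w > 0" "u \<le> v"
  shows "cmod (exp (- (w * u)) - exp (- (w * v))) \<le> cmod w / Re w * (exp (- (Re w * u)) - exp (- (Re w * v)))"
proof (cases "u = v")
  case False
  then have uv: "u < v" using assms by simp
  \<comment> \<open>An antiderivative of \<open>cmod w * exp (- (Re w * x))\<close>, so that a mean
    value inequality can replace the integral.\<close>
  define \<phi> where "\<phi> = (\<lambda>x. - (cmod w / Re w * exp (- (Re w * x))))"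
  have "cmod (exp (- (w * v)) - exp (- (w * u))) \<le> \<phi> v - \<phi> u"
  proof (rule differentiable_bound_general[OF uv])
    show "continuous_on {u..v} (\<lambda>x. exp (- (w * complex_of_real x)))"
      by (intro continuous_intros)
    show "continuous_on {u..v} \<phi>"
      unfolding \<phi>_def by (intro continuous_intros)
    fix x :: real
    have "((\<lambda>z. exp (- (w * z))) has_field_derivative (- w * exp (- (w * x)))) (at (complex_of_real x))"
      by (auto intro!: derivative_eq_intros)
    then show "((\<lambda>x. exp (- (w * complex_of_real x))) has_vector_derivative (- w * exp (- (w * x)))) (at x)"
      by (rule has_vector_derivative_real_field)
    show "(\<phi> has_vector_derivative (cmod w * exp (- (Re w * x)))) (at x)"
      unfolding \<phi>_def has_real_derivative_iff_has_vector_derivative[symmetric]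
      using assms by (auto intro!: derivative_eq_intros)
    show "cmod (- w * exp (- (w * x))) \<le> cmod w * exp (- (Re w * x))"
      by (simp add: norm_mult)
  qed
  then show ?thesis
    by (simp add: \<phi>_def norm_minus_commute algebra_simps)
qed simp

lemma abel_summation:
  fixes b g :: "nat \<Rightarrow> 'a::comm_ring"
  shows "(\<Sum>k<K. b k * g k) =
    (\<Sum>j<K. b j) * g K + (\<Sum>k<K. (\<Sum>j<Suc k. b j) * (g k - g (Suc k)))"
  by (induction K) (simp_all add: algebra_simps)

text \<open>Abel summation transfers the bound on the sums of \<open>b\<close> to the weighted sum:
  by \<open>norm_exp_diff_le\<close> the variation of the weights telescopes to at most
  \<open>cmod w / Re w\<close>, independently of \<open>K\<close>.\<close>

lemma norm_general_dirichlet_sum_le: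
  fixes b :: "nat \<Rightarrow> complex" and l :: "nat \<Rightarrow> real"
  assumes M: "\<And>k. cmod (\<Sum>j<k. b j) \<le> M"
    and l: "\<And>k. 0 \<le> l k" "\<And>k. l k \<le> l (Suc k)" and w: "Re w > 0"
  shows "cmod (\<Sum>k<K. b k * exp (- (w * l k))) \<le> M * (1 + cmod w / Re w)"
proof -
  have M0: "M \<ge> 0" using M[of 0] by simp
  define g where "g = (\<lambda>k. exp (- (w * l k)))"
  define e where "e = (\<lambda>k. exp (- (Re w * l k)))"
  have e: "0 < e k" "e k \<le> 1" for k
    using w l by (auto simp: e_def)
  have "(\<Sum>k<K. b k * exp (- (w * l k))) = (\<Sum>k<K. b k * g k)"
    by (simp add: g_def)
  also have "cmod \<dots> \<le>
      cmod ((\<Sum>j<K. b j) * g K) + cmod (\<Sum>k<K. (\<Sum>j<Suc k. b j) * (g k - g (Suc k)))"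
    by (subst abel_summation) (rule norm_triangle_ineq)
  also have "\<dots> \<le> M * 1 + (\<Sum>k<K. M * (cmod w / Re w * (e k - e (Suc k))))"
  proof (intro add_mono order_trans[OF norm_sum] sum_mono)
    have "cmod (g K) \<le> 1" using e(2)[of K] by (simp add: g_def e_def)
    then show "cmod ((\<Sum>j<K. b j) * g K) \<le> M * 1"
      unfolding norm_mult using M M0 by (intro mult_mono) auto
    fix k
    have "cmod (g k - g (Suc k)) \<le> cmod w / Re w * (e k - e (Suc k))"
      unfolding g_def e_def by (intro norm_exp_diff_le w l)
    then show "cmod ((\<Sum>j<Suc k. b j) * (g k - g (Suc k))) \<le> M * (cmod w / Re w * (e k - e (Suc k)))"
      unfolding norm_mult using M0 by (intro mult_mono M) auto
  qed
  also have "\<dots> = M * 1 + M * (cmod w / Re w * (\<Sum>k<K. e k - e (Suc k)))"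
    by (simp add: sum_distrib_left)
  also have "\<dots> = M * 1 + M * (cmod w / Re w * (e 0 - e K))"
    by (simp add: sum_lessThan_telescope')
  also have "\<dots> \<le> M * 1 + M * (cmod w / Re w * 1)"
    using e(1)[of K] e(2)[of 0] w M0 by (intro add_left_mono mult_left_mono) auto
  finally show ?thesis by (simp add: algebra_simps)
qed

section \<open>Convergence, holomorphy and Gaussian averages on the half-plane\<close>

abbreviation half_plane :: "complex set" where
  "half_plane \<equiv> {s. Re s > 0}"

lemma open_half_plane: "open half_plane"
  by (rule open_halfspace_Re_gt)

lemma convex_half_plane: "convex half_plane"
  by (rule convex_halfspace_Re_gt)

text \<open>The coefficient \<open>c n\<close> belongs to the integer \<open>n + 1\<close>, whose
  power with exponent \<open>- s\<close> is written as an exponential so that the estimate for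
  general exponents applies.\<close>

locale convergent_dirichlet_series =
  fixes c :: "nat \<Rightarrow> complex" and f :: "complex \<Rightarrow> complex"
  assumes sums: "Re s > 0 \<Longrightarrow> (\<lambda>n. c n * exp (- (s * ln (real (Suc n))))) sums f s"
begin

definition psum :: "nat \<Rightarrow> complex \<Rightarrow> complex" where
  "psum N s = (\<Sum>n<N. c n * exp (- (s * ln (real (Suc n)))))"

lemma shift_exponent:
  "exp (- (complex_of_real \<sigma> * u)) * exp (- ((s - \<sigma>) * u)) = exp (- (s * u))"
  by (simp add: exp_add[symmetric] algebra_simps)

text \<open>Convergence at the real point \<open>\<sigma>\<close> bounds the partial sums there;
  absorbing the values of the exponentials at \<open>\<sigma>\<close> into the coefficients replaces
  \<open>s\<close> by \<open>s - \<sigma>\<close>. On a vertical line the bound grows only linearly,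
  which a Gaussian weight integrates.\<close>

lemma psum_bound:
  assumes \<sigma>: "\<sigma> > 0"
  obtains M where "M \<ge> 0"
    "\<And>N s. Re s > \<sigma> \<Longrightarrow> cmod (psum N s) \<le> M * (1 + cmod (s - \<sigma>) / (Re s - \<sigma>))"
proof -
  have "convergent (\<lambda>N. psum N \<sigma>)"
    using sums[of \<sigma>] \<sigma> unfolding psum_def by (auto simp: sums_def convergent_def)
  then have "Bseq (\<lambda>N. psum N \<sigma>)"
    by (rule convergent_imp_Bseq)
  then obtain M where M: "M > 0" "\<And>N. cmod (psum N \<sigma>) \<le> M"
    by (auto simp: Bseq_def)
  show ?thesis
  proof (rule that[of M])
    fix N s assume s: "Re s > \<sigma>"
    have "cmod (\<Sum>n<N. c n * exp (- (complex_of_real \<sigma> * ln (real (Suc n)))) * exp (- ((s - \<sigma>) * ln (real (Suc n)))))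
        \<le> M * (1 + cmod (s - \<sigma>) / Re (s - \<sigma>))"
      using M(2) s unfolding psum_def by (intro norm_general_dirichlet_sum_le) auto
    then show "cmod (psum N s) \<le> M * (1 + cmod (s - \<sigma>) / (Re s - \<sigma>))"
      unfolding mult.assoc shift_exponent psum_def by simp
  qed (use M in simp)
qed

text \<open>The same argument works for blocks of terms beyond \<open>N0\<close>, whose sums at
  \<open>\<sigma>\<close> are below \<open>e\<close> by the Cauchy criterion; then the length of the
  block tends to infinity.\<close>

lemma psum_uniform_approx:
  assumes \<sigma>: "\<sigma> > 0" and e: "e > 0"
  obtains N0 where
    "\<And>N s. N \<ge> N0 \<Longrightarrow> Re s > \<sigma> \<Longrightarrow> cmod (f s - psum N s) \<le> e * (1 + cmod (s - \<sigma>) / (Re s - \<sigma>))"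
proof -
  have "Cauchy (\<lambda>N. psum N \<sigma>)"
    using sums[of \<sigma>] \<sigma> unfolding psum_def
    by (intro convergent_Cauchy) (auto simp: sums_def convergent_def)
  then obtain N0 where N0: "\<And>m n. m \<ge> N0 \<Longrightarrow> n \<ge> N0 \<Longrightarrow> dist (psum m \<sigma>) (psum n \<sigma>) < e"
    using e by (meson Cauchy_def)
  have split: "psum (N + k) s - psum N s = (\<Sum>j<k. c (N + j) * exp (- (s * ln (real (Suc (N + j))))))" for N k s
    by (induction k) (simp_all add: psum_def algebra_simps)
  show ?thesis
  proof (rule that[of N0])
    fix N s assume N: "N \<ge> N0" and s: "Re s > \<sigma>"
    have le: "cmod (psum (N + k) s - psum N s) \<le> e * (1 + cmod (s - \<sigma>) / (Re s - \<sigma>))" for k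
    proof -
      have "cmod (\<Sum>j<k. c (N + j) * exp (- (complex_of_real \<sigma> * ln (real (Suc (N + j))))) *
                exp (- ((s - \<sigma>) * ln (real (Suc (N + j))))))
          \<le> e * (1 + cmod (s - \<sigma>) / Re (s - \<sigma>))"
      proof (intro norm_general_dirichlet_sum_le)
        show "cmod (\<Sum>j<k. c (N + j) * exp (- (complex_of_real \<sigma> * ln (real (Suc (N + j)))))) \<le> e" for k
          using N0[of "N + k" N] N unfolding split[symmetric] dist_norm by simp
      qed (use s in auto)
      then show ?thesis
        unfolding mult.assoc shift_exponent split by simp
    qed
    have "(\<lambda>k. psum k s) \<longlonglongrightarrow> f s"
      using sums[of s] s \<sigma> unfolding psum_def sums_def by simp
    then have "(\<lambda>k. psum (N + k) s) \<longlonglongrightarrow> f s"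
      by (subst add.commute) (rule LIMSEQ_ignore_initial_segment)
    then have "(\<lambda>k. cmod (psum (N + k) s - psum N s)) \<longlonglongrightarrow> cmod (f s - psum N s)"
      by (intro tendsto_intros)
    then show "cmod (f s - psum N s) \<le> e * (1 + cmod (s - \<sigma>) / (Re s - \<sigma>))"
      by (rule Lim_bounded) (use le in blast)
  qed
qed

lemma holomorphic: "f holomorphic_on half_plane"
proof (rule holomorphic_uniform_sequence[OF open_half_plane])
  show "psum n holomorphic_on half_plane" for n
    unfolding psum_def by (intro holomorphic_intros)
  fix z assume "z \<in> half_plane"
  \<comment> \<open>The disc of radius \<open>2 * r\<close> around \<open>z\<close> stays at
    distance at least \<open>r\<close> from the line of real part \<open>r\<close>, so on it the
    factor in \<open>psum_uniform_approx\<close> is at most \<open>Q\<close>.\<close>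
  define r where "r = Re z / 4"
  have r: "r > 0" "Re z = 4 * r" using \<open>z \<in> _\<close> by (auto simp: r_def)
  define Q where "Q = 1 + (cmod z + 3 * r) / r"
  have Q: "Q > 0" using r by (simp add: Q_def add_pos_nonneg)
  have near: "Re s > r \<and> 1 + cmod (s - r) / (Re s - r) \<le> Q" if s: "s \<in> cball z (2 * r)" for s
  proof -
    have "\<bar>Re (z - s)\<bar> \<le> 2 * r" using s abs_Re_le_cmod[of "z - s"] by (simp add: dist_norm)
    then have Re: "Re s \<ge> 2 * r" using r by simp
    have "cmod (s - r) \<le> cmod z + cmod (s - z) + cmod (complex_of_real r)"
      using norm_triangle_ineq4[of s "complex_of_real r"] norm_triangle_ineq[of z "s - z"] by simp
    then have "cmod (s - r) \<le> cmod z + 3 * r"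
      using s r by (simp add: dist_norm norm_minus_commute)
    then show ?thesis
      using Re r unfolding Q_def by (auto intro!: frac_le)
  qed
  have "uniform_limit (cball z (2 * r)) psum f sequentially"
  proof (rule uniform_limitI)
    fix e :: real assume "e > 0"
    then obtain N0 where N0: "\<And>N s. N \<ge> N0 \<Longrightarrow> Re s > r \<Longrightarrow>
        cmod (f s - psum N s) \<le> e / (2 * Q) * (1 + cmod (s - r) / (Re s - r))"
      using psum_uniform_approx[of r "e / (2 * Q)"] r Q by (metis divide_pos_pos mult_pos_pos zero_less_numeral)
    have "dist (psum N s) (f s) < e" if "N \<ge> N0" "s \<in> cball z (2 * r)" for N s
    proof -
      have "cmod (f s - psum N s) \<le> e / (2 * Q) * (1 + cmod (s - r) / (Re s - r))"
        using N0 near that by blast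
      also have "\<dots> \<le> e / (2 * Q) * Q"
        using near that \<open>e > 0\<close> Q by (intro mult_left_mono) auto
      also have "\<dots> < e" using Q \<open>e > 0\<close> by simp
      finally show ?thesis by (simp add: dist_norm norm_minus_commute)
    qed
    then show "\<forall>\<^sub>F N in sequentially. \<forall>s\<in>cball z (2 * r). dist (psum N s) (f s) < e"
      unfolding eventually_sequentially by blast
  qed
  moreover have "cball z (2 * r) \<subseteq> half_plane"
    using near r by fastforce
  ultimately show "\<exists>d>0. cball z d \<subseteq> half_plane \<and> uniform_limit (cball z d) psum f sequentially"
    using r by (intro exI[of _ "2 * r"]) auto
qed

text \<open>Averaging over a normally distributed vertical translation multiplies the \<open>n\<close>-th coefficient
  by \<open>exp (-(e ln n)\<^sup>2/2)\<close>, which makes the series absolutely convergent up to the boundary.\<close>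

lemma gaussian_average_sums:
  fixes e :: real
  assumes s: "Re s > 0"
  shows "integrable std_normal_distribution (\<lambda>x. f (s + \<i> * (e * x)))" (is ?int)
    and "(\<lambda>n. c n * exp (- ((e * ln (real (Suc n)))\<^sup>2) / 2) * exp (- (s * ln (real (Suc n))))) sums
      (LINT x|std_normal_distribution. f (s + \<i> * (e * x)))" (is "?X sums _")
proof -
  interpret real_distribution std_normal_distribution by (rule real_dist_normal_dist)
  \<comment> \<open>Half of \<open>Re s\<close> keeps the whole vertical line through
    \<open>s\<close> at distance \<open>\<sigma>\<close> from the line of real part
    \<open>\<sigma>\<close>.\<close>
  define \<sigma> where "\<sigma> = Re s / 2"
  have \<sigma>: "\<sigma> > 0" "Re s - \<sigma> = \<sigma>" using s by (auto simp: \<sigma>_def)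
  obtain M where M: "M \<ge> 0"
    "\<And>N s. Re s > \<sigma> \<Longrightarrow> cmod (psum N s) \<le> M * (1 + cmod (s - \<sigma>) / (Re s - \<sigma>))"
    using psum_bound[OF \<sigma>(1)] by blast
  have hp: "Re (s + \<i> * (e * x)) > 0" for x :: real using s by simp
  \<comment> \<open>A majorant of all partial sums along the vertical line. Being affine in
    \<open>\<bar>x\<bar>\<close> it is integrable for the normal law, and dominated convergence
    permits averaging term by term.\<close>
  define w where "w = (\<lambda>x::real. M * (1 + (cmod (s - \<sigma>) + \<bar>e\<bar> * \<bar>x\<bar>) / \<sigma>))"
  have int_abs: "integrable std_normal_distribution (\<lambda>x. \<bar>x\<bar>)"
    using integrable_abs[OF integrable_std_normal_distribution_moment[of 1]] by simp
  have wint: "integrable std_normal_distribution w"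
    unfolding w_def by (intro integrable_mult_right Bochner_Integration.integrable_add integrable_divide int_abs) auto
  have bnd: "cmod (psum N (s + \<i> * (e * x))) \<le> w x" for N and x :: real
  proof -
    have "cmod (psum N (s + \<i> * (e * x))) \<le> M * (1 + cmod (s + \<i> * (e * x) - \<sigma>) / \<sigma>)"
      using M(2)[of "s + \<i> * (e * x)" N] \<sigma> by simp
    also have "\<dots> \<le> w x"
    proof -
      have "cmod (s + \<i> * (e * x) - \<sigma>) \<le> cmod (s - \<sigma>) + cmod (\<i> * (e * x))"
        by (metis add_diff_eq add.commute diff_add_eq norm_triangle_ineq)
      then have "cmod (s + \<i> * (e * x) - \<sigma>) \<le> cmod (s - \<sigma>) + \<bar>e\<bar> * \<bar>x\<bar>"
        by (simp add: norm_mult)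
      then show ?thesis
        unfolding w_def using M(1) \<sigma> by (intro mult_left_mono add_left_mono divide_right_mono) auto
    qed
    finally show ?thesis .
  qed
  have lim: "(\<lambda>N. psum N (s + \<i> * (e * x))) \<longlonglongrightarrow> f (s + \<i> * (e * x))" for x :: real
    using sums[OF hp] unfolding psum_def sums_def .
  have meas_psum: "(\<lambda>x::real. psum N (s + \<i> * (e * x))) \<in> borel_measurable std_normal_distribution" for N
    unfolding psum_def by measurable
  have meas: "(\<lambda>x::real. f (s + \<i> * (e * x))) \<in> borel_measurable std_normal_distribution"
    by (rule borel_measurable_LIMSEQ_metric[OF meas_psum lim])
  show ?int
    by (rule integrable_dominated_convergence[where s = "\<lambda>N x. psum N (s + \<i> * (e * x))" and w = w])
       (use meas meas_psum wint lim bnd in auto)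
  have "(\<lambda>N. LINT x|std_normal_distribution. psum N (s + \<i> * (e * x))) \<longlonglongrightarrow>
      (LINT x|std_normal_distribution. f (s + \<i> * (e * x)))"
    by (rule integral_dominated_convergence[where s = "\<lambda>N x. psum N (s + \<i> * (e * x))" and w = w])
       (use meas meas_psum wint lim bnd in auto)
  moreover have "(LINT x|std_normal_distribution. psum N (s + \<i> * (e * x))) = (\<Sum>n<N. ?X n)" for N
  proof -
    \<comment> \<open>The translation enters each term only through a character of \<open>x\<close>,
      so the average is a value of the characteristic function of the normal law.\<close>
    have eq: "c n * exp (- ((s + \<i> * (e * x)) * ln (real (Suc n)))) =
        c n * exp (- (s * ln (real (Suc n)))) * iexp (- (e * ln (real (Suc n))) * x)" for n and x :: real
      by (simp add: exp_add[symmetric] algebra_simps del: of_nat_Suc)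
    have ie: "integrable std_normal_distribution (\<lambda>x. iexp (t * x))" for t
      by (intro integrable_iexp) auto
    have "(LINT x|std_normal_distribution. psum N (s + \<i> * (e * x))) =
      (\<Sum>n<N. c n * exp (- (s * ln (real (Suc n)))) * char std_normal_distribution (- (e * ln (real (Suc n)))))"
      unfolding psum_def eq char_def
      by (subst Bochner_Integration.integral_sum;
          (intro integrable_mult_right ie | simp only: integral_mult_right_zero))
    then show ?thesis
      unfolding char_std_normal_distribution
      by (simp add: exp_of_real[symmetric] mult_ac del: of_nat_Suc)
  qed
  ultimately show "?X sums (LINT x|std_normal_distribution. f (s + \<i> * (e * x)))"
    by (simp add: sums_def)
qed

text \<open>Convergence at 1 forces \<open>c n\<close> to grow at most linearly, and a Gaussian in
  \<open>ln n\<close> decays faster than every power of \<open>n\<close>.\<close>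

lemma summable_gaussian_coeffs:
  assumes e: "e > 0"
  shows "summable (\<lambda>n. cmod (c n) * exp (- ((e * ln (real (Suc n)))\<^sup>2) / 2))"
proof -
  have "summable (\<lambda>n. c n * exp (- (1 * complex_of_real (ln (real (Suc n))))))"
    using sums[of 1] by (intro sums_summable[of _ "f 1"]) simp
  then have "Bseq (\<lambda>n. c n * exp (- (1 * complex_of_real (ln (real (Suc n))))))"
    using summable_LIMSEQ_zero convergent_imp_Bseq convergentI by blast
  then obtain K where K: "K > 0" "\<And>n. cmod (c n * exp (- (1 * complex_of_real (ln (real (Suc n)))))) \<le> K"
    by (auto simp: Bseq_def)
  have c: "cmod (c n) \<le> K * real (Suc n)" for n
  proof -
    have "cmod (exp (- (1 * complex_of_real (ln (real (Suc n)))))) = 1 / real (Suc n)"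
      unfolding norm_exp_eq_Re by (simp add: exp_minus inverse_eq_divide del: of_nat_Suc)
    then have "cmod (c n) / real (Suc n) \<le> K"
      using K(2)[of n] by (simp add: norm_mult del: of_nat_Suc)
    then show ?thesis by (simp add: pos_divide_le_eq del: of_nat_Suc)
  qed
  have ev: "\<forall>\<^sub>F n in sequentially. real (Suc n) * exp (- ((e * ln (real (Suc n)))\<^sup>2) / 2) \<le> 1 / real (Suc n) ^ 2"
    using e by real_asymp
  have "summable (\<lambda>n. K * (1 / real (Suc n) ^ 2))"
    using summable_mult[OF summable_Suc_iff[THEN iffD2, OF inverse_power_summable[of 2, where 'a = real]], of K]
    by (simp add: field_simps)
  then show ?thesis
  proof (rule summable_comparison_test_ev[rotated])
    show "\<forall>\<^sub>F n in sequentially. norm (cmod (c n) * exp (- ((e * ln (real (Suc n)))\<^sup>2) / 2)) \<le> K * (1 / real (Suc n) ^ 2)"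
      using ev
    proof eventually_elim
      case (elim n)
      have "cmod (c n) * exp (- ((e * ln (real (Suc n)))\<^sup>2) / 2) \<le> (K * real (Suc n)) * exp (- ((e * ln (real (Suc n)))\<^sup>2) / 2)"
        by (intro mult_right_mono c) auto
      also have "\<dots> = K * (real (Suc n) * exp (- ((e * ln (real (Suc n)))\<^sup>2) / 2))" by (simp only: mult.assoc)
      also have "\<dots> \<le> K * (1 / real (Suc n) ^ 2)"
        using K(1) by (intro mult_left_mono elim) auto
      finally show ?case by simp
    qed
  qed
qed

text \<open>Two errors of at most \<open>\<epsilon> / 2\<close> add up. Averaging is controlled by
  the bounded derivative; truncating the averaged series is controlled uniformly in
  \<open>s\<close>, since its exponentials have modulus at most 1.\<close>

lemma uniform_dirichlet_polynomial_approx: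
  assumes L: "\<And>s. Re s > 0 \<Longrightarrow> cmod (deriv f s) \<le> L" and "\<epsilon> > 0"
  shows "\<exists>N d. \<forall>s. Re s > 0 \<longrightarrow> cmod (f s - (\<Sum>n<N. d n * exp (- (s * ln (real (Suc n)))))) \<le> \<epsilon>"
proof -
  interpret real_distribution std_normal_distribution by (rule real_dist_normal_dist)
  have L0: "L \<ge> 0" using order_trans[OF norm_ge_zero L[of 1]] by simp
  define K where "K = (LINT x|std_normal_distribution. \<bar>x\<bar>)"
  have int_abs: "integrable std_normal_distribution (\<lambda>x. \<bar>x\<bar>)"
    using integrable_abs[OF integrable_std_normal_distribution_moment[of 1]] by simp
  have K0: "K \<ge> 0" unfolding K_def by (rule integral_nonneg_AE) auto
  \<comment> \<open>Makes the averaging error \<open>e * L * K\<close> at most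
    \<open>\<epsilon> / 2\<close>, where \<open>K\<close> is the mean modulus of a standard normal
    variable; the added 1 excludes a zero denominator.\<close>
  define e where "e = \<epsilon> / (2 * (L * K + 1))"
  have LK: "L * K + 1 > 0" using L0 K0 by (simp add: add_nonneg_pos)
  have e: "e > 0" unfolding e_def using LK \<open>\<epsilon> > 0\<close> by simp
  have eLK: "e * L * K \<le> \<epsilon> / 2"
  proof -
    have "e * (L * K) \<le> e * (L * K + 1)" using e by (intro mult_left_mono) auto
    also have "\<dots> = \<epsilon> / 2" using LK by (simp add: e_def field_simps)
    finally show ?thesis by (simp add: mult.assoc)
  qed
  define d where "d = (\<lambda>n. c n * exp (- ((e * ln (real (Suc n)))\<^sup>2) / 2))"
  have nd: "cmod (d n) = cmod (c n) * exp (- ((e * ln (real (Suc n)))\<^sup>2) / 2)" for n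
    unfolding d_def norm_mult by (simp del: of_nat_Suc)
  have sumd: "summable (\<lambda>n. cmod (d n))"
    unfolding nd by (rule summable_gaussian_coeffs[OF e])
  have "\<exists>N. \<forall>n\<ge>N. norm (\<Sum>i. cmod (d (i + n))) < \<epsilon> / 2"
    using suminf_exist_split[OF _ sumd, of "\<epsilon> / 2"] \<open>\<epsilon> > 0\<close> by simp
  then obtain N where "norm (\<Sum>i. cmod (d (i + N))) < \<epsilon> / 2" by blast
  then have N: "(\<Sum>i. cmod (d (i + N))) < \<epsilon> / 2" by simp
  have "cmod (f s - (\<Sum>n<N. d n * exp (- (s * ln (real (Suc n)))))) \<le> \<epsilon>" if s: "Re s > 0" for s
  proof -
    let ?I = "LINT x|std_normal_distribution. f (s + \<i> * (e * x))"
    let ?t = "\<lambda>n. d n * exp (- (s * ln (real (Suc n))))"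
    note ga = gaussian_average_sums[OF s, of e]
    have "cmod (?I - f s) \<le> e * L * K"
    proof -
      have "?I - f s = (LINT x|std_normal_distribution. f (s + \<i> * (e * x)) - f s)"
        using ga(1) by (subst Bochner_Integration.integral_diff) (auto simp: prob_space[simplified])
      also have "cmod \<dots> \<le> (LINT x|std_normal_distribution. cmod (f (s + \<i> * (e * x)) - f s))"
        by (rule integral_norm_bound)
      also have "\<dots> \<le> (LINT x|std_normal_distribution. e * L * \<bar>x\<bar>)"
      proof (rule integral_mono)
        show "integrable std_normal_distribution (\<lambda>x. cmod (f (s + \<i> * (e * x)) - f s))"
          using ga(1) by (intro integrable_norm Bochner_Integration.integrable_diff) auto
        show "integrable std_normal_distribution (\<lambda>x. e * L * \<bar>x\<bar>)"
          by (intro integrable_mult_right int_abs)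
        fix x :: real
        have "cmod (f (s + \<i> * (e * x)) - f s) \<le> L * cmod (s + \<i> * (e * x) - s)"
        proof (rule field_differentiable_bound[OF convex_half_plane])
          show "(f has_field_derivative deriv f z) (at z within half_plane)" if "z \<in> half_plane" for z
            using holomorphic_derivI[OF holomorphic open_half_plane that] has_field_derivative_at_within by blast
        qed (use L s in auto)
        then show "cmod (f (s + \<i> * (e * x)) - f s) \<le> e * L * \<bar>x\<bar>"
          using e by (simp add: norm_mult mult_ac)
      qed
      also have "\<dots> = e * L * K" by (simp add: K_def)
      finally show ?thesis .
    qed
    moreover have "cmod (?I - (\<Sum>n<N. ?t n)) \<le> \<epsilon> / 2"
    proof -
      have tb: "cmod (?t n) \<le> cmod (d n)" for n
      proof -
        have "cmod (exp (- (s * ln (real (Suc n))))) \<le> 1" using s by simp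
        then show ?thesis unfolding norm_mult by (intro mult_left_le) auto
      qed
      have sm: "summable (\<lambda>n. cmod (d (n + N)))" by (rule summable_ignore_initial_segment[OF sumd])
      have "?t sums ?I" using ga(2) unfolding d_def .
      then have "(\<lambda>n. ?t (n + N)) sums (?I - (\<Sum>n<N. ?t n))"
        by (rule sums_split_initial_segment)
      then have "?I - (\<Sum>n<N. ?t n) = (\<Sum>n. ?t (n + N))" by (simp add: sums_iff)
      also have "cmod \<dots> \<le> (\<Sum>n. cmod (d (n + N)))"
        by (rule norm_suminf_le[OF tb sm]) 
      finally show ?thesis using N by simp
    qed
    ultimately have "cmod ((?I - (\<Sum>n<N. ?t n)) - (?I - f s)) \<le> \<epsilon>"
      using eLK norm_triangle_ineq4[of "?I - (\<Sum>n<N. ?t n)" "?I - f s"] by linarith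
    then show ?thesis by simp
  qed
  then show ?thesis by blast
qed

end

section \<open>Functions on the type of points of the half-plane\<close>

text \<open>Passes to a function of a complex variable, to which complex analysis applies. Values
  off the half-plane are arbitrary; as the half-plane is open, they do not affect derivatives inside
  it.\<close>

definition lift :: "(right_half_plane \<Rightarrow> complex) \<Rightarrow> complex \<Rightarrow> complex" where
  "lift f z = f (right_half_plane_of z)"

abbreviation hp_holomorphic :: "(right_half_plane \<Rightarrow> complex) \<Rightarrow> bool" where
  "hp_holomorphic f \<equiv> lift f holomorphic_on half_plane"

lemma Re_point_of: "Re (point_of s) > 0"
  using point_of[of s] by simp

lemma lift_point_of [simp]: "lift f (point_of s) = f s"
  by (simp add: lift_def point_of_inverse)

lemma point_of_right_half_plane_of: "Re z > 0 \<Longrightarrow> point_of (right_half_plane_of z) = z"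
  by (rule right_half_plane_of_inverse) simp

lemma lift_hp_deriv: "Re z > 0 \<Longrightarrow> lift (hp_deriv f) z = deriv (lift f) z"
  by (simp add: lift_def[abs_def] hp_deriv_def point_of_right_half_plane_of)

text \<open>The two sides need agree only on the half-plane; openness turns this into agreement near
  \<open>z\<close>, which is enough to differentiate once more.\<close>

lemma lift_hp_deriv_funpow: "Re z > 0 \<Longrightarrow> lift ((hp_deriv ^^ l) f) z = (deriv ^^ l) (lift f) z"
proof (induction l arbitrary: z)
  case (Suc l)
  have "\<forall>\<^sub>F w in nhds z. w \<in> half_plane"
    using Suc.prems open_half_plane by (intro eventually_nhds_in_open) auto
  then have "\<forall>\<^sub>F w in nhds z. lift ((hp_deriv ^^ l) f) w = (deriv ^^ l) (lift f) w"
    by eventually_elim (use Suc.IH in auto)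
  then have "deriv (lift ((hp_deriv ^^ l) f)) z = deriv ((deriv ^^ l) (lift f)) z"
    by (rule deriv_cong_ev) simp
  then show ?case using Suc.prems by (simp add: lift_hp_deriv)
qed simp

lemma hp_deriv_funpow_eq: "(hp_deriv ^^ l) f s = (deriv ^^ l) (lift f) (point_of s)"
  using lift_hp_deriv_funpow[OF Re_point_of, of l f s] by simp

lemma hp_deriv_eq: "hp_deriv f s = deriv (lift f) (point_of s)"
  using hp_deriv_funpow_eq[of 1] by simp

lemma hp_deriv_funpow_add:
  assumes "hp_holomorphic f" "hp_holomorphic g"
  shows "(hp_deriv ^^ l) (\<lambda>s. f s + g s) = (\<lambda>s. (hp_deriv ^^ l) f s + (hp_deriv ^^ l) g s)"
proof
  fix s
  have "lift (\<lambda>s. f s + g s) = (\<lambda>z. lift f z + lift g z)" by (simp add: lift_def fun_eq_iff)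
  then show "(hp_deriv ^^ l) (\<lambda>s. f s + g s) s = (hp_deriv ^^ l) f s + (hp_deriv ^^ l) g s"
    using higher_deriv_add[OF assms open_half_plane, of "point_of s"] Re_point_of
    by (simp add: hp_deriv_funpow_eq)
qed

lemma hp_deriv_funpow_cmult:
  assumes "hp_holomorphic f"
  shows "(hp_deriv ^^ l) (\<lambda>s. c * f s) = (\<lambda>s. c * (hp_deriv ^^ l) f s)"
proof
  fix s
  have "lift (\<lambda>s. c * f s) = (\<lambda>z. c * lift f z)" by (simp add: lift_def fun_eq_iff)
  then show "(hp_deriv ^^ l) (\<lambda>s. c * f s) s = c * (hp_deriv ^^ l) f s"
    using higher_deriv_cmult[OF assms _ open_half_plane, of "point_of s"] Re_point_of
    by (simp add: hp_deriv_funpow_eq)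
qed

lemma hp_deriv_funpow_mult:
  assumes "hp_holomorphic f" "hp_holomorphic g"
  shows "(hp_deriv ^^ l) (\<lambda>s. f s * g s) =
    (\<lambda>s. \<Sum>i\<le>l. of_nat (l choose i) * ((hp_deriv ^^ i) f s * (hp_deriv ^^ (l - i)) g s))"
proof
  fix s
  have "lift (\<lambda>s. f s * g s) = (\<lambda>z. lift f z * lift g z)" by (simp add: lift_def fun_eq_iff)
  then show "(hp_deriv ^^ l) (\<lambda>s. f s * g s) s =
      (\<Sum>i\<le>l. of_nat (l choose i) * ((hp_deriv ^^ i) f s * (hp_deriv ^^ (l - i)) g s))"
    using higher_deriv_mult[OF assms open_half_plane, of "point_of s"] Re_point_of
    by (simp add: hp_deriv_funpow_eq atLeast0AtMost mult.assoc)
qed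

lemma hp_deriv_funpow_zero: "(hp_deriv ^^ l) (\<lambda>s. 0) = (\<lambda>s. 0)"
  by (induction l) (auto simp: hp_deriv_def)

lemma hp_deriv_funpow_const: "(hp_deriv ^^ l) (\<lambda>s. c) = (if l = 0 then \<lambda>s. c else (\<lambda>s. 0))"
proof (cases l)
  case (Suc k)
  have "hp_deriv (\<lambda>s. c) = (\<lambda>s. 0)" by (auto simp: hp_deriv_def)
  then show ?thesis
    using hp_deriv_funpow_zero by (simp add: Suc funpow_Suc_right del: funpow.simps)
qed simp

section \<open>Elements of \<open>Hinf\<close> as convergent Dirichlet series, and their
  approximation\<close>

lemma divide_powr_eq:
  fixes c s :: complex
  shows "c / of_nat (Suc n) powr s = c * exp (- (s * ln (real (Suc n))))"
proof -
  have "of_nat (Suc n) powr s = exp (s * complex_of_real (ln (real (Suc n))))"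
    by (subst powr_def) (simp add: Ln_of_nat del: of_nat_Suc)
  then show ?thesis by (simp add: exp_minus divide_inverse)
qed

lemma Hinf_convergent_dirichlet_series:
  assumes "f \<in> Hinf"
  obtains c where "convergent_dirichlet_series c (lift f)"
proof -
  obtain a where a: "\<And>s. (\<lambda>n. a (Suc n) / of_nat (Suc n) powr point_of s) sums f s"
    using assms by (auto simp: Hinf_def)
  have "convergent_dirichlet_series (\<lambda>n. a (Suc n)) (lift f)"
  proof
    fix s assume "Re s > 0"
    then show "(\<lambda>n. a (Suc n) * exp (- (s * ln (real (Suc n))))) sums lift f s"
      using a[of "right_half_plane_of s"]
      by (simp add: divide_powr_eq point_of_right_half_plane_of lift_def del: of_nat_Suc)
  qed
  then show ?thesis by (rule that)
qed

lemma Hinf_holomorphic: "f \<in> Hinf \<Longrightarrow> hp_holomorphic f"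
  by (metis Hinf_convergent_dirichlet_series convergent_dirichlet_series.holomorphic)

lemma exp_sum_in_dirichlet_polys:
  "(\<lambda>s. \<Sum>n<N. d n * exp (- (point_of s * ln (real (Suc n))))) \<in> dirichlet_polys"
proof -
  \<comment> \<open>Shifts the index by one. The extra coefficient 0 at \<open>Suc N\<close> ensures
    at least one term even for \<open>N = 0\<close>.\<close>
  define a where "a = (\<lambda>n. if n \<le> N then d (n - 1) else 0)"
  have "(\<Sum>n<N. d n * exp (- (point_of s * ln (real (Suc n))))) =
      (\<Sum>n=1..Suc N. a n / of_nat n powr point_of s)" for s
    by (simp add: sum.atLeast1_atMost_eq divide_powr_eq a_def del: of_nat_Suc)
  then show ?thesis
    unfolding dirichlet_polys_def by (intro CollectI exI[of _ "Suc N"] exI[of _ a] conjI) auto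
qed

text \<open>The approximation is in the supremum norm, not in the norm of a smaller algebra; the
  Wiener property will make up for the difference.\<close>

lemma dirichlet_polys_dense:
  assumes f: "f \<in> Hinf" and bd: "bounded (range (hp_deriv f))" and e: "e > 0"
  shows "\<exists>p\<in>dirichlet_polys. \<forall>s. cmod (f s - p s) \<le> e"
proof -
  obtain c where "convergent_dirichlet_series c (lift f)"
    using Hinf_convergent_dirichlet_series[OF f] .
  then interpret convergent_dirichlet_series c "lift f" .
  obtain L where "\<And>s. cmod (hp_deriv f s) \<le> L"
    using bd by (auto simp: bounded_iff)
  then have "cmod (deriv (lift f) z) \<le> L" if "Re z > 0" for z
    using lift_hp_deriv[OF that] by (metis lift_def)
  from uniform_dirichlet_polynomial_approx[OF this e] obtain N d where
    "\<And>z. Re z > 0 \<Longrightarrow> cmod (lift f z - (\<Sum>n<N. d n * exp (- (z * ln (real (Suc n)))))) \<le> e"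
    by blast
  from this[OF Re_point_of] show ?thesis
    by (intro bexI[OF _ exp_sum_in_dirichlet_polys[of d N]]) (simp del: of_nat_Suc)
qed

section \<open>Algebras of Dirichlet series and of their derivatives\<close>

locale dirichlet_algebra = sup_dominating_algebra B nrm C
  for B :: "(right_half_plane \<Rightarrow> complex) set" and nrm C +
  assumes polys: "dirichlet_polys \<subseteq> B" and subset_Hinf: "B \<subseteq> Hinf"
    and wiener: "wiener_property B"
begin

section \<open>Invertible elements and exponentials in an algebra of Dirichlet series\<close>

lemma holomorphic: "f \<in> B \<Longrightarrow> hp_holomorphic f"
  using subset_Hinf Hinf_holomorphic by blast

text \<open>The Wiener property enters here: it reduces invertibility along a path to a lower bound
  on the modulus.\<close>

lemma ex_inverse:
  assumes f: "f \<in> B" and lb: "\<And>s. \<delta> \<le> cmod (f s)" and "\<delta> > 0"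
  shows "\<exists>q\<in>B. \<forall>s. f s * q s = 1"
proof -
  have "(INF s. cmod (f s)) \<ge> \<delta>" by (rule cINF_greatest) (use lb in auto)
  with \<open>\<delta> > 0\<close> have "(INF s. cmod (f s)) > 0" by linarith
  then have "(\<lambda>s. 1 / f s) \<in> B"
    using wiener f unfolding wiener_property_def by blast
  moreover have "f s * (1 / f s) = 1" for s using lb[of s] \<open>\<delta> > 0\<close> by auto
  ultimately show ?thesis by (intro bexI[of _ "\<lambda>s. 1 / f s"] allI)
qed

lemma monomial_closed:
  assumes "n \<ge> 1"
  shows "(\<lambda>s. 1 / of_nat n powr point_of s) \<in> B"
proof -
  have "(\<lambda>s. 1 / of_nat n powr point_of s) =
      (\<lambda>s. \<Sum>k=1..n. (if k = n then 1 else 0) / of_nat k powr point_of s)"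
  proof
    fix s
    have "(\<Sum>k=1..n. (if k = n then 1 else 0) / of_nat k powr point_of s) =
        (\<Sum>k=1..n. if k = n then 1 / of_nat n powr point_of s else 0)"
      by (intro sum.cong) auto
    then show "1 / of_nat n powr point_of s =
        (\<Sum>k=1..n. (if k = n then 1 else 0) / of_nat k powr point_of s)"
      using assms by simp
  qed
  moreover have "\<dots> \<in> dirichlet_polys"
    unfolding dirichlet_polys_def by (intro CollectI exI conjI, rule assms, rule refl)
  ultimately show ?thesis using polys by auto
qed

text \<open>The translates \<open>p(s + \<sigma>)\<close>, written with \<open>t = exp (-\<sigma>)\<close>, connect a Dirichlet polynomial
  bounded away from zero to its constant coefficient.\<close>

lemma dirichlet_poly_exponential:
  assumes p: "p \<in> dirichlet_polys" and lb: "\<And>s. \<delta> \<le> cmod (p s)" and \<delta>: "\<delta> > 0"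
  shows "p \<in> exponentials"
proof -
  obtain N a where N: "N \<ge> 1" and p_eq: "p = (\<lambda>s. \<Sum>n=1..N. a n / of_nat n powr point_of s)"
    using p by (auto simp: dirichlet_polys_def)
  define E where "E = (\<lambda>n s. 1 / of_nat n powr point_of s)"
  \<comment> \<open>For \<open>t = exp (- \<sigma>)\<close> the factor is \<open>n\<close> to the
    power \<open>- \<sigma>\<close>. The case \<open>n = 1\<close> is separate because
    \<open>0 powr 0\<close> is 0, which would delete the constant term at
    \<open>t = 0\<close>.\<close>
  define \<kappa> :: "nat \<Rightarrow> real \<Rightarrow> complex" where
    "\<kappa> = (\<lambda>n t. if n = 1 then a 1 else a n * complex_of_real (t powr ln (real n)))"
  define P where "P = (\<lambda>t s. \<Sum>n=1..N. \<kappa> n t * E n s)"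
  have EB: "E n \<in> B" if "n \<in> {1..N}" for n
    using monomial_closed[of n] that by (simp add: E_def)
  have \<kappa>_cont: "continuous_on {0..1} (\<kappa> n)" if "n \<in> {1..N}" for n
  proof (cases "n = 1")
    case False
    then have "ln (real n) > 0" using that by simp
    then have "continuous_on {0..1} (\<lambda>t. t powr ln (real n))"
      by (intro continuous_on_powr' continuous_intros) auto
    with False show ?thesis unfolding \<kappa>_def by (simp add: continuous_intros)
  qed (simp add: \<kappa>_def)
  have PB: "P t \<in> B" for t
    unfolding P_def by (intro sum_closed scale_closed EB)
  \<comment> \<open>For \<open>0 < t \<le> 1\<close> the function \<open>P t\<close> is the
    translate of \<open>p\<close> by \<open>- ln t \<ge> 0\<close> and inherits its lower bound;
    continuity in \<open>t\<close> extends the bound to \<open>t = 0\<close>.\<close>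
  have lbP: "\<delta> \<le> cmod (P t s)" if t: "t \<in> {0..1}" for t s
  proof (rule continuous_ge_on_closure[where S = "{0<..1}" and f = "\<lambda>t. cmod (P t s)"])
    show "continuous_on (closure {0<..1}) (\<lambda>t. cmod (P t s))"
      unfolding P_def using \<kappa>_cont by (auto intro!: continuous_intros)
    show "t \<in> closure {0<..1}" using t by simp
    fix u :: real assume u: "u \<in> {0<..1}"
    define z where "z = point_of s - ln u"
    have "ln u \<le> 0" using u by simp
    then have z: "Re z > 0" using Re_point_of[of s] by (simp add: z_def)
    have "\<kappa> n u * E n s = a n / of_nat n powr z" if n: "n \<in> {1..N}" for n
    proof (cases "n = 1")
      case False
      have "of_nat n powr z = exp (z * complex_of_real (ln (real n)))"
        using n by (subst powr_def) auto
      also have "\<dots> = of_nat n powr point_of s * exp (- (ln u * ln (real n)))"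
        using n unfolding z_def
        by (subst powr_def) (auto simp: exp_of_real[symmetric] exp_add[symmetric] algebra_simps)
      finally have "of_nat n powr z * complex_of_real (u powr ln (real n)) = of_nat n powr point_of s"
        using u by (simp add: powr_def exp_minus mult.commute)
      moreover have "of_nat n powr z \<noteq> 0" "of_nat n powr point_of s \<noteq> 0" using n by auto
      ultimately show ?thesis using False by (simp add: \<kappa>_def E_def field_simps)
    qed (simp add: \<kappa>_def E_def)
    then have "P u s = p (right_half_plane_of z)"
      by (simp add: P_def p_eq point_of_right_half_plane_of[OF z])
    then show "\<delta> \<le> cmod (P u s)" using lb by simp
  qed
  have "P 1 \<in> exponentials"
  proof (rule exponentials_path)
    show "P t \<in> B" for t by (rule PB)
  next
    fix t :: real assume t: "t \<in> {0..1}"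
    show "\<exists>q\<in>B. \<forall>s. P t s * q s = 1"
      using lbP[OF t] by (intro ex_inverse[OF PB _ \<delta>])
    \<comment> \<open>Only finitely many coefficients vary with \<open>t\<close>, so their
      continuity makes the path continuous in \<open>nrm\<close>.\<close>
    have bnd: "nrm (\<lambda>s. P u s - P t s) \<le> (\<Sum>n=1..N. cmod (\<kappa> n u - \<kappa> n t) * nrm (E n))" for u
    proof -
      have "(\<lambda>s. P u s - P t s) = (\<lambda>s. \<Sum>n=1..N. (\<kappa> n u - \<kappa> n t) * E n s)"
        by (simp add: P_def sum_subtractf left_diff_distrib)
      then have "nrm (\<lambda>s. P u s - P t s) \<le> (\<Sum>n=1..N. nrm (\<lambda>s. (\<kappa> n u - \<kappa> n t) * E n s))"
        using norm_sum_le[of "{1..N}" "\<lambda>n s. (\<kappa> n u - \<kappa> n t) * E n s"] scale_closed EB by metis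
      then show ?thesis using EB by (simp add: norm_scale)
    qed
    have "((\<lambda>u. \<Sum>n=1..N. cmod (\<kappa> n u - \<kappa> n t) * nrm (E n)) \<longlongrightarrow>
        (\<Sum>n=1..N. cmod (\<kappa> n t - \<kappa> n t) * nrm (E n))) (at t within {0..1})"
      using \<kappa>_cont t by (intro tendsto_intros) (auto simp: continuous_on_def)
    then have lim: "((\<lambda>u. \<Sum>n=1..N. cmod (\<kappa> n u - \<kappa> n t) * nrm (E n)) \<longlongrightarrow> 0) (at t within {0..1})"
      by simp
    show "((\<lambda>u. nrm (\<lambda>s. P u s - P t s)) \<longlongrightarrow> 0) (at t within {0..1})"
      by (rule tendsto_sandwich[OF _ _ tendsto_const lim])
         (use bnd in \<open>auto intro!: always_eventually norm_nonneg diff_closed PB simp del: sum.cl_ivl_Suc One_nat_def\<close>)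
  next
    \<comment> \<open>Only the constant coefficient survives at the end of the path; the lower bound
      makes it nonzero, so it has a complex logarithm.\<close>
    have P0: "P 0 s = a 1" for s
    proof -
      have "P 0 s = (\<Sum>n=1..N. if n = 1 then a 1 else 0)"
        unfolding P_def by (intro sum.cong refl) (auto simp: \<kappa>_def E_def)
      then show ?thesis using N by simp
    qed
    have "a 1 \<noteq> 0" using lbP[of 0 undefined] \<delta> by (auto simp: P0)
    then have "P 0 s = exp (Ln (a 1))" for s using P0 by simp
    then show "P 0 \<in> exponentials"
      unfolding exponentials_def
      by (intro CollectI bexI[of _ "\<lambda>s. Ln (a 1)"] allI) (simp_all only: const_closed)
  qed
  moreover have "\<kappa> n 1 = a n" for n by (simp add: \<kappa>_def)
  then have "P 1 = p" by (simp add: P_def p_eq E_def)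
  ultimately show ?thesis by simp
qed

text \<open>The segment from \<open>f\<close> to a uniformly close Dirichlet polynomial consists of invertible elements,
  thanks to the Wiener property, although the two need not be close in the norm of \<open>B\<close>.\<close>

lemma exponential_if_bounded_below:
  assumes f: "f \<in> B" and f': "hp_deriv f \<in> B" and lb: "\<And>s. \<delta> \<le> cmod (f s)" and \<delta>: "\<delta> > 0"
  shows "f \<in> exponentials"
proof -
  have "bounded (range (hp_deriv f))" using f' subset_Hinf by (auto simp: Hinf_def)
  \<comment> \<open>Distance \<open>\<delta> / 2\<close> leaves modulus at least
    \<open>\<delta> / 2\<close> on the whole segment from \<open>p\<close> to
    \<open>f\<close>.\<close>
  then obtain p where p: "p \<in> dirichlet_polys" and close: "\<And>s. cmod (f s - p s) \<le> \<delta> / 2"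
    using dirichlet_polys_dense[of f "\<delta> / 2"] f subset_Hinf \<delta> by auto
  have pB: "p \<in> B" using p polys by blast
  define P where "P = (\<lambda>(t::real) s. p s + t * (f s - p s))"
  have PB: "P t \<in> B" for t
    unfolding P_def by (intro add_closed scale_closed diff_closed pB f)
  have lbP: "\<delta> / 2 \<le> cmod (P t s)" if t: "t \<in> {0..1}" for t s
  proof -
    have "f s = P t s + complex_of_real (1 - t) * (f s - p s)"
      by (simp add: P_def algebra_simps)
    then have "cmod (f s) \<le> cmod (P t s) + cmod (complex_of_real (1 - t) * (f s - p s))"
      by (metis norm_triangle_ineq)
    moreover have "cmod (complex_of_real (1 - t) * (f s - p s)) \<le> 1 * (\<delta> / 2)"
      unfolding norm_mult norm_of_real using t close by (intro mult_mono) auto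
    ultimately show ?thesis using lb[of s] by simp
  qed
  have "P 1 \<in> exponentials"
  proof (rule exponentials_path)
    show "P t \<in> B" for t by (rule PB)
    fix t :: real assume t: "t \<in> {0..1}"
    show "\<exists>q\<in>B. \<forall>s. P t s * q s = 1"
      using PB lbP[OF t] \<delta> by (intro ex_inverse[of _ "\<delta> / 2"]) auto
    \<comment> \<open>The segment is Lipschitz in \<open>nrm\<close> with constant
      \<open>nrm (\<lambda>s. f s - p s)\<close>, however large that is.\<close>
    have "(\<lambda>s. P u s - P t s) = (\<lambda>s. complex_of_real (u - t) * (f s - p s))" for u
      by (simp add: P_def algebra_simps)
    then have "nrm (\<lambda>s. P u s - P t s) = cmod (complex_of_real (u - t)) * nrm (\<lambda>s. f s - p s)" for u
      using norm_scale[OF diff_closed[OF f pB]] by presburger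
    moreover have "((\<lambda>u. cmod (complex_of_real (u - t)) * nrm (\<lambda>s. f s - p s)) \<longlongrightarrow>
        cmod (complex_of_real (t - t)) * nrm (\<lambda>s. f s - p s)) (at t within {0..1})"
      by (intro tendsto_intros)
    ultimately show "((\<lambda>u. nrm (\<lambda>s. P u s - P t s)) \<longlongrightarrow> 0) (at t within {0..1})" by simp
  next
    have "P 0 = p" by (simp add: P_def)
    then show "P 0 \<in> exponentials"
      using dirichlet_poly_exponential[OF p, of "\<delta> / 2"] lbP[of 0] \<delta> by simp
  qed
  moreover have "P 1 = f" by (simp add: P_def)
  ultimately show ?thesis by simp
qed

section \<open>The differentiable elements as a Banach algebra\<close>

lemma deriv_algebra_iff: "f \<in> deriv_algebra k B \<longleftrightarrow> (\<forall>l\<le>k. (hp_deriv ^^ l) f \<in> B)"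
proof
  assume f: "f \<in> deriv_algebra k B"
  show "\<forall>l\<le>k. (hp_deriv ^^ l) f \<in> B"
  proof (intro allI impI)
    fix l assume "l \<le> k"
    then show "(hp_deriv ^^ l) f \<in> B"
      using f by (cases "l = 0") (auto simp: deriv_algebra_def)
  qed
next
  assume *: "\<forall>l\<le>k. (hp_deriv ^^ l) f \<in> B"
  from *[rule_format, of 0] have "f \<in> B" by simp
  with * show "f \<in> deriv_algebra k B" by (auto simp: deriv_algebra_def)
qed

lemma deriv_algebra_Suc_iff:
  "f \<in> deriv_algebra (Suc k) B \<longleftrightarrow> f \<in> B \<and> hp_deriv f \<in> deriv_algebra k B"
proof -
  have "(\<forall>l\<le>Suc k. (hp_deriv ^^ l) f \<in> B) \<longleftrightarrow> f \<in> B \<and> (\<forall>l\<le>k. (hp_deriv ^^ Suc l) f \<in> B)"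
    by (subst All_less_Suc2[where n = "Suc k", unfolded less_Suc_eq_le]) simp
  then show ?thesis
    by (simp add: deriv_algebra_iff funpow_Suc_right del: funpow.simps)
qed

lemma deriv_algebra_subset: "k \<le> k' \<Longrightarrow> deriv_algebra k' B \<subseteq> deriv_algebra k B"
  by (auto simp: deriv_algebra_iff)

text \<open>Differentiation is a closed operator. Convergence in \<open>nrm\<close> is uniform on
  the half-plane, so by Weierstrass the derivatives converge pointwise to the derivative of
  \<open>L\<close>, while \<open>lim'\<close> sends them to \<open>L'\<close>.\<close>

lemma hp_deriv_uniform_limit:
  assumes X: "\<And>n. hp_holomorphic (X n)" and X': "\<And>n. hp_deriv (X n) \<in> B"
    and XB: "\<And>n. X n \<in> B" and L: "L \<in> B" and L': "L' \<in> B"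
    and lim: "(\<lambda>n. nrm (\<lambda>s. X n s - L s)) \<longlonglongrightarrow> 0"
    and lim': "(\<lambda>n. nrm (\<lambda>s. hp_deriv (X n) s - L' s)) \<longlonglongrightarrow> 0"
  shows "hp_deriv L = L'"
proof -
  have unif: "uniform_limit half_plane (\<lambda>n. lift (X n)) (lift L) sequentially"
  proof (rule uniform_limitI)
    fix e :: real assume "e > 0"
    then have "\<forall>\<^sub>F n in sequentially. C * nrm (\<lambda>s. X n s - L s) < e"
      using order_tendstoD(2)[OF tendsto_mult_right_zero[OF lim, of C]] by simp
    then show "\<forall>\<^sub>F n in sequentially. \<forall>z\<in>half_plane. dist (lift (X n) z) (lift L z) < e"
    proof eventually_elim
      case (elim n)
      then show ?case
        using eval_bound[OF diff_closed[OF XB[of n] L]]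
        by (auto simp: dist_norm lift_def intro: order.strict_trans1)
    qed
  qed
  have "\<exists>g'. \<forall>z\<in>half_plane. (lift L has_field_derivative g' z) (at z) \<and>
      (\<lambda>n. deriv (lift (X n)) z) \<longlonglongrightarrow> g' z"
  proof (rule has_complex_derivative_uniform_sequence[OF open_half_plane])
    show "(lift (X n) has_field_derivative deriv (lift (X n)) z) (at z)" if "z \<in> half_plane" for n z
      using holomorphic_derivI[OF X open_half_plane that] .
    show "\<exists>d>0. cball z d \<subseteq> half_plane \<and> uniform_limit (cball z d) (\<lambda>n. lift (X n)) (lift L) sequentially"
      if "z \<in> half_plane" for z
      using open_contains_cball[of half_plane] open_half_plane that uniform_limit_on_subset[OF unif] by blast
  qed
  then obtain g' where g': "\<And>z. Re z > 0 \<Longrightarrow> (lift L has_field_derivative g' z) (at z)"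
    "\<And>z. Re z > 0 \<Longrightarrow> (\<lambda>n. deriv (lift (X n)) z) \<longlonglongrightarrow> g' z"
    by auto
  have "hp_deriv L s = L' s" for s
  proof (rule LIMSEQ_unique)
    show "(\<lambda>n. hp_deriv (X n) s) \<longlonglongrightarrow> hp_deriv L s"
      using g'[OF Re_point_of[of s]] by (simp add: hp_deriv_eq DERIV_imp_deriv)
    show "(\<lambda>n. hp_deriv (X n) s) \<longlonglongrightarrow> L' s"
      by (rule tendsto_eval[where X = "\<lambda>n. hp_deriv (X n)"]) (use X' L' lim' in auto)
  qed
  then show ?thesis by blast
qed

text \<open>For each order up to \<open>k\<close> the derivatives form a Cauchy sequence in
  \<open>B\<close>; closedness of differentiation shows that the limits are the derivatives of the
  limit of order 0.\<close>

lemma deriv_algebra_complete: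
  assumes X: "\<forall>n. X n \<in> deriv_algebra k B"
    and Cauchy: "\<forall>e>0. \<exists>M. \<forall>i\<ge>M. \<forall>j\<ge>M. deriv_norm k nrm (\<lambda>s. X i s - X j s) < e"
  shows "\<exists>L\<in>deriv_algebra k B. (\<lambda>n. deriv_norm k nrm (\<lambda>s. X n s - L s)) \<longlonglongrightarrow> 0"
proof -
  let ?D = "\<lambda>l. hp_deriv ^^ l"
  have DX: "?D l (X n) \<in> B" if "l \<le> k" for l n
    using X that by (auto simp: deriv_algebra_iff)
  have XB: "X n \<in> B" for n using DX[of 0] by simp
  have diff: "?D l (\<lambda>s. f s - g s) = (\<lambda>s. ?D l f s - ?D l g s)" if "f \<in> B" "g \<in> B" for l f g
    using hp_deriv_funpow_add[OF holomorphic[OF that(1)] holomorphic[OF uminus_closed[OF that(2)]], of l]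
      hp_deriv_funpow_cmult[OF holomorphic[OF that(2)], of l "-1"] by simp
  have comp: "nrm (\<lambda>s. ?D l (X i) s - ?D l (X j) s) \<le> fact l * deriv_norm k nrm (\<lambda>s. X i s - X j s)"
    if l: "l \<le> k" for l i j
  proof -
    have "1 / fact l * nrm (?D l (\<lambda>s. X i s - X j s)) \<le> deriv_norm k nrm (\<lambda>s. X i s - X j s)"
      unfolding deriv_norm_def diff[OF XB XB] using l
      by (intro member_le_sum[where f = "\<lambda>l. 1 / fact l * nrm (\<lambda>s. ?D l (X i) s - ?D l (X j) s)"])
         (auto intro!: divide_nonneg_nonneg norm_nonneg diff_closed DX)
    then show ?thesis by (simp add: diff[OF XB XB] field_simps)
  qed
  have "\<exists>L\<in>B. (\<lambda>n. nrm (\<lambda>s. ?D l (X n) s - L s)) \<longlonglongrightarrow> 0" if l: "l \<le> k" for l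
  proof (rule norm_complete)
    show "\<forall>e>0. \<exists>M. \<forall>i\<ge>M. \<forall>j\<ge>M. nrm (\<lambda>s. ?D l (X i) s - ?D l (X j) s) < e"
    proof (intro allI impI)
      fix e :: real assume "e > 0"
      then have "e / fact l > 0" by simp
      then obtain M where M: "\<forall>i\<ge>M. \<forall>j\<ge>M. deriv_norm k nrm (\<lambda>s. X i s - X j s) < e / fact l"
        using Cauchy by blast
      have "nrm (\<lambda>s. ?D l (X i) s - ?D l (X j) s) < e" if "i \<ge> M" "j \<ge> M" for i j
      proof -
        have "deriv_norm k nrm (\<lambda>s. X i s - X j s) < e / fact l" using M that by blast
        then have "fact l * deriv_norm k nrm (\<lambda>s. X i s - X j s) < e"
          by (simp add: field_simps)
        with comp[OF l] show ?thesis by (rule order.strict_trans1)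
      qed
      then show "\<exists>M. \<forall>i\<ge>M. \<forall>j\<ge>M. nrm (\<lambda>s. ?D l (X i) s - ?D l (X j) s) < e" by blast
    qed
  qed (use DX[OF l] in blast)
  then have "\<forall>l. \<exists>L. l \<le> k \<longrightarrow> L \<in> B \<and> (\<lambda>n. nrm (\<lambda>s. ?D l (X n) s - L s)) \<longlonglongrightarrow> 0"
    by blast
  from choice[OF this] obtain L where L: "\<And>l. l \<le> k \<Longrightarrow> L l \<in> B"
    "\<And>l. l \<le> k \<Longrightarrow> (\<lambda>n. nrm (\<lambda>s. ?D l (X n) s - L l s)) \<longlonglongrightarrow> 0"
    by blast
  have DL: "?D l (L 0) = L l" if "l \<le> k" for l
    using that
  proof (induction l)
    case (Suc l)
    have "hp_deriv (L l) = L (Suc l)"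
      using Suc.prems DX[of "Suc l"] L(2)[of "Suc l"]
      by (intro hp_deriv_uniform_limit[of "\<lambda>n. ?D l (X n)"] holomorphic DX L) auto
    with Suc show ?case by simp
  qed simp
  have L0: "L 0 \<in> deriv_algebra k B"
    using DL L(1) by (auto simp: deriv_algebra_iff)
  have "(\<lambda>n. \<Sum>l=0..k. 1 / fact l * nrm (\<lambda>s. ?D l (X n) s - L l s)) \<longlonglongrightarrow> (\<Sum>l=0..k. 1 / fact l * 0)"
    by (intro tendsto_sum tendsto_mult_left L(2)) auto
  also have "(\<lambda>n. \<Sum>l=0..k. 1 / fact l * nrm (\<lambda>s. ?D l (X n) s - L l s)) =
      (\<lambda>n. deriv_norm k nrm (\<lambda>s. X n s - L 0 s))"
    unfolding deriv_norm_def diff[OF XB L(1)[of 0, simplified]]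
    by (intro ext sum.cong refl) (simp add: DL)
  finally show ?thesis using L0 by auto
qed

text \<open>The weights \<open>1 / fact l\<close> absorb the binomial coefficients of the Leibniz
  rule, which leaves part of the Cauchy product of the two norms.\<close>

lemma deriv_norm_submult:
  assumes f: "f \<in> deriv_algebra k B" and g: "g \<in> deriv_algebra k B"
  shows "(\<lambda>s. f s * g s) \<in> deriv_algebra k B"
    and "deriv_norm k nrm (\<lambda>s. f s * g s) \<le> deriv_norm k nrm f * deriv_norm k nrm g"
proof -
  let ?D = "\<lambda>l. hp_deriv ^^ l"
  have D: "?D l f \<in> B" "?D l g \<in> B" if "l \<le> k" for l
    using f g that by (auto simp: deriv_algebra_iff)
  have fg: "f \<in> B" "g \<in> B" using D[of 0] by auto
  note leibniz = hp_deriv_funpow_mult[OF holomorphic[OF fg(1)] holomorphic[OF fg(2)]]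
  have term_closed: "(\<lambda>s. of_nat (l choose i) * (?D i f s * ?D (l - i) g s)) \<in> B" if "l \<le> k" "i \<le> l" for l i
    using that by (intro scale_closed mult_closed D) auto
  show "(\<lambda>s. f s * g s) \<in> deriv_algebra k B"
    unfolding deriv_algebra_iff leibniz by (intro allI impI sum_closed term_closed) auto
  define a where "a = (\<lambda>i. 1 / fact i * nrm (?D i f))"
  define b where "b = (\<lambda>i. 1 / fact i * nrm (?D i g))"
  have ab0: "0 \<le> a i" "0 \<le> b i" if "i \<le> k" for i
    using D[OF that] unfolding a_def b_def by (simp_all add: norm_nonneg)
  have le: "1 / fact l * nrm (?D l (\<lambda>s. f s * g s)) \<le> (\<Sum>i\<le>l. a i * b (l - i))" if l: "l \<le> k" for l
  proof -
    have "nrm (?D l (\<lambda>s. f s * g s)) \<le>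
        (\<Sum>i\<le>l. nrm (\<lambda>s. of_nat (l choose i) * (?D i f s * ?D (l - i) g s)))"
      unfolding leibniz using l by (intro norm_sum_le term_closed) auto
    also have "\<dots> \<le> (\<Sum>i\<le>l. fact l * (a i * b (l - i)))"
    proof (intro sum_mono)
      fix i assume "i \<in> {..l}"
      then have i: "i \<le> l" "i \<le> k" "l - i \<le> k" using l by auto
      have "nrm (\<lambda>s. of_nat (l choose i) * (?D i f s * ?D (l - i) g s)) =
          real (l choose i) * nrm (\<lambda>s. ?D i f s * ?D (l - i) g s)"
        using i by (subst norm_scale) (auto intro!: mult_closed D)
      also have "\<dots> \<le> real (l choose i) * (nrm (?D i f) * nrm (?D (l - i) g))"
        using i by (intro mult_left_mono norm_submult D) auto
      also have "\<dots> = fact l * (a i * b (l - i))"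
        using i by (simp add: a_def b_def binomial_fact field_simps)
      finally show "nrm (\<lambda>s. of_nat (l choose i) * (?D i f s * ?D (l - i) g s)) \<le> fact l * (a i * b (l - i))" .
    qed
    finally show ?thesis by (simp add: sum_distrib_left[symmetric] field_simps)
  qed
  have "deriv_norm k nrm (\<lambda>s. f s * g s) \<le> (\<Sum>l\<le>k. \<Sum>i\<le>l. a i * b (l - i))"
    unfolding deriv_norm_def atLeast0AtMost by (intro sum_mono le) auto
  also have "\<dots> = (\<Sum>(i, j)\<in>{(i, j). i + j \<le> k}. a i * b j)"
    by (rule sum.triangle_reindex_eq[symmetric])
  \<comment> \<open>The triangle \<open>i + j \<le> k\<close> is enlarged to a square, all terms
    being nonnegative.\<close>
  also have "\<dots> \<le> (\<Sum>(i, j)\<in>{..k} \<times> {..k}. a i * b j)"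
    using ab0 by (intro sum_mono2) auto
  also have "\<dots> = (\<Sum>i\<le>k. a i) * (\<Sum>j\<le>k. b j)"
    by (simp add: sum_product sum.cartesian_product)
  also have "\<dots> = deriv_norm k nrm f * deriv_norm k nrm g"
    by (simp add: deriv_norm_def a_def b_def atLeast0AtMost)
  finally show "deriv_norm k nrm (\<lambda>s. f s * g s) \<le> deriv_norm k nrm f * deriv_norm k nrm g" .
qed

lemma norm_le_deriv_norm:
  assumes "f \<in> deriv_algebra k B"
  shows "nrm f \<le> deriv_norm k nrm f"
proof -
  have "1 / fact 0 * nrm ((hp_deriv ^^ 0) f) \<le> deriv_norm k nrm f"
    unfolding deriv_norm_def using assms
    by (intro member_le_sum) (auto simp: deriv_algebra_iff intro!: divide_nonneg_nonneg norm_nonneg)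
  then show ?thesis by simp
qed

text \<open>Makes the exponential series available for differentiable elements. The constant stays
  the same because \<open>deriv_norm k nrm\<close> dominates \<open>nrm\<close>.\<close>

lemma sup_dominating_deriv_algebra:
  "sup_dominating_algebra (deriv_algebra k B) (deriv_norm k nrm) C"
proof
  let ?A = "deriv_algebra k B" and ?D = "\<lambda>l. hp_deriv ^^ l"
  have AB: "f \<in> B" if "f \<in> ?A" for f using that by (auto simp: deriv_algebra_def)
  have DB: "?D l f \<in> B" if "f \<in> ?A" "l \<le> k" for l f using that by (auto simp: deriv_algebra_iff)
  have add: "?D l (\<lambda>s. f s + g s) = (\<lambda>s. ?D l f s + ?D l g s)" if "f \<in> ?A" "g \<in> ?A" for l f g
    using hp_deriv_funpow_add holomorphic AB that by blast
  have cmult: "?D l (\<lambda>s. c * f s) = (\<lambda>s. c * ?D l f s)" if "f \<in> ?A" for l c f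
    using hp_deriv_funpow_cmult holomorphic AB that by blast
  show "(\<lambda>s. 0) \<in> ?A" by (simp add: deriv_algebra_iff hp_deriv_funpow_zero zero_closed)
  show "(\<lambda>s. 1) \<in> ?A"
    by (simp add: deriv_algebra_iff hp_deriv_funpow_const zero_closed one_closed)
  show "1 \<le> C" by (rule C_ge_1)
  fix f assume f: "f \<in> ?A"
  show "(\<lambda>s. c * f s) \<in> ?A" for c
    using f by (simp add: deriv_algebra_iff cmult[OF f] scale_closed)
  show nonneg: "0 \<le> deriv_norm k nrm f"
    unfolding deriv_norm_def by (intro sum_nonneg mult_nonneg_nonneg norm_nonneg DB f) auto
  show "deriv_norm k nrm (\<lambda>s. c * f s) = cmod c * deriv_norm k nrm f" for c
    unfolding deriv_norm_def cmult[OF f] sum_distrib_left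
    by (intro sum.cong refl) (simp add: norm_scale[OF DB[OF f]])
  show "deriv_norm k nrm f = 0 \<longleftrightarrow> f = (\<lambda>s. 0)"
  proof
    assume "deriv_norm k nrm f = 0"
    then have "nrm f = 0"
      using norm_le_deriv_norm[OF f] norm_nonneg[OF AB[OF f]] by simp
    then show "f = (\<lambda>s. 0)" by (simp add: norm_eq_0_iff[OF AB[OF f]])
  qed (simp add: deriv_norm_def hp_deriv_funpow_zero norm_zero)
  show "cmod (f s) \<le> C * deriv_norm k nrm f" for s
  proof -
    have "C * nrm f \<le> C * deriv_norm k nrm f"
      using C_ge_1 norm_le_deriv_norm[OF f] by (intro mult_left_mono) auto
    with eval_bound[OF AB[OF f]] show ?thesis by (rule order_trans)
  qed
  fix g assume g: "g \<in> ?A"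
  show "(\<lambda>s. f s + g s) \<in> ?A"
    using f g by (simp add: deriv_algebra_iff add[OF f g] add_closed)
  show "(\<lambda>s. f s * g s) \<in> ?A"
    "deriv_norm k nrm (\<lambda>s. f s * g s) \<le> deriv_norm k nrm f * deriv_norm k nrm g"
    by (rule deriv_norm_submult[OF f g])+
  show "deriv_norm k nrm (\<lambda>s. f s + g s) \<le> deriv_norm k nrm f + deriv_norm k nrm g"
    unfolding deriv_norm_def add[OF f g] sum.distrib[symmetric] distrib_left[symmetric]
    by (intro sum_mono mult_left_mono norm_triangle DB f g) auto
qed (rule deriv_algebra_complete)

text \<open>A logarithm of an invertible element inherits differentiability from \<open>h' = f' / f\<close>.\<close>

lemma logarithm_in_deriv_algebra:
  assumes f: "f \<in> deriv_algebra m B" and g: "g \<in> deriv_algebra m B" and fg: "\<And>s. f s * g s = 1"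
    and h: "h \<in> B" and fh: "\<And>s. f s = exp (h s)"
  shows "h \<in> deriv_algebra m B"
proof -
  \<comment> \<open>Differentiating \<open>f = exp h\<close> gives \<open>f' = f h'\<close>, and
    \<open>g\<close> is the inverse of \<open>f\<close>.\<close>
  have "hp_deriv h s = hp_deriv f s * g s" for s
  proof -
    have "lift f = (\<lambda>z. exp (lift h z))" by (simp add: lift_def fh fun_eq_iff)
    moreover have "(lift h has_field_derivative deriv (lift h) (point_of s)) (at (point_of s))"
      by (rule holomorphic_derivI[OF holomorphic[OF h] open_half_plane]) (simp add: Re_point_of)
    then have "((\<lambda>z. exp (lift h z)) has_field_derivative exp (lift h (point_of s)) * deriv (lift h) (point_of s))
        (at (point_of s))"
      by (rule DERIV_fun_exp)
    ultimately have "hp_deriv f s = f s * hp_deriv h s"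
      by (simp add: hp_deriv_eq fh DERIV_imp_deriv)
    then show ?thesis using fg[of s] by (simp add: mult_ac)
  qed
  then have h': "hp_deriv h = (\<lambda>s. hp_deriv f s * g s)" by blast
  \<comment> \<open>Each round gains one derivative: for \<open>k < m\<close> both \<open>f'\<close>
    and \<open>g\<close> have \<open>k\<close> derivatives in \<open>B\<close>, hence so does
    \<open>h'\<close>.\<close>
  have "h \<in> deriv_algebra k B" if "k \<le> m" for k
    using that
  proof (induction k)
    case 0
    then show ?case using h by (simp add: deriv_algebra_def)
  next
    case (Suc k)
    have "hp_deriv f \<in> deriv_algebra k B"
      using f deriv_algebra_subset[OF Suc.prems] deriv_algebra_Suc_iff by blast
    moreover have "g \<in> deriv_algebra k B"
      using g deriv_algebra_subset[of k m] Suc.prems by auto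
    ultimately have "hp_deriv h \<in> deriv_algebra k B"
      unfolding h' by (rule deriv_norm_submult)
    with h show ?case by (simp add: deriv_algebra_Suc_iff)
  qed
  then show ?thesis by simp
qed

end

section \<open>Equality of the invertible elements with the exponentials\<close>

theorem corollary3p2:
  fixes m :: nat
    and B :: "(right_half_plane \<Rightarrow> complex) set"
    and nrm :: "(right_half_plane \<Rightarrow> complex) \<Rightarrow> real"
  assumes "m \<ge> 1"
    and "pointwise_banach_algebra B nrm"
    and "dirichlet_polys \<subseteq> B" and "B \<subseteq> Hinf"
    and "\<exists>C>0. \<forall>f\<in>B. Hinf_norm f \<le> C * nrm f"
    and "wiener_property B"
  shows "invertibles (deriv_algebra m B) =
         algebra_exp (deriv_algebra m B) (deriv_norm m nrm) ` deriv_algebra m B"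
proof -
  obtain C0 where C0: "C0 > 0" "\<And>f. f \<in> B \<Longrightarrow> Hinf_norm f \<le> C0 * nrm f"
    using assms(5) by blast
  interpret pointwise_banach_algebra B nrm by fact
  have one: "(\<lambda>s. 1) \<in> B"
  proof -
    have "(\<lambda>s. 1) = (\<lambda>s. \<Sum>n=1..1. 1 / of_nat n powr point_of s)" by simp
    moreover have "\<dots> \<in> dirichlet_polys"
      unfolding dirichlet_polys_def by (intro CollectI exI conjI, rule order_refl, rule refl)
    ultimately show ?thesis using assms(3) by auto
  qed
  \<comment> \<open>The constant is raised to at least 1, so that smallness of
    \<open>C * nrm v\<close> includes smallness of \<open>nrm v\<close>.\<close>
  interpret dirichlet_algebra B nrm "max 1 C0"
  proof
    fix f s assume f: "f \<in> B"
    then have "bounded (range f)" using assms(4) by (auto simp: Hinf_def)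
    then have "bdd_above (range (\<lambda>s. cmod (f s)))"
      by (auto simp: bounded_iff bdd_above_def)
    then have "cmod (f s) \<le> Hinf_norm f"
      unfolding Hinf_norm_def by (rule cSUP_upper[OF UNIV_I])
    also have "\<dots> \<le> C0 * nrm f" by (rule C0(2)[OF f])
    also have "\<dots> \<le> max 1 C0 * nrm f"
      using norm_nonneg[OF f] by (intro mult_right_mono) auto
    finally show "cmod (f s) \<le> max 1 C0 * nrm f" .
  qed (use assms one in auto)
  interpret D: sup_dominating_algebra "deriv_algebra m B" "deriv_norm m nrm" "max 1 C0"
    by (rule sup_dominating_deriv_algebra)
  show ?thesis
  proof (intro equalityI subsetI)
    fix f assume "f \<in> invertibles (deriv_algebra m B)"
    then obtain g where f: "f \<in> deriv_algebra m B" and g: "g \<in> deriv_algebra m B"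
      and fg: "\<And>s. f s * g s = 1"
      by (auto simp: invertibles_def)
    have fB: "f \<in> B" and gB: "g \<in> B" using f g by (auto simp: deriv_algebra_def)
    \<comment> \<open>Here \<open>m \<ge> 1\<close> is used: the first derivative lies in
      \<open>B\<close> and is therefore bounded.\<close>
    have f'B: "hp_deriv f \<in> B"
      using f assms(1) by (auto simp: deriv_algebra_def dest: bspec[of _ _ 1])
    \<comment> \<open>A positive bound for the modulus of the inverse \<open>g\<close>, so that
      \<open>1 / K\<close> is a lower bound for that of \<open>f\<close>.\<close>
    define K where "K = max 1 C0 * nrm g + 1"
    have gK: "cmod (g s) \<le> K" for s using eval_bound[OF gB, of s] by (simp add: K_def)
    have K: "K > 0" using norm_nonneg[OF gB] by (simp add: K_def add_nonneg_pos)
    have "1 / K \<le> cmod (f s)" for s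
    proof -
      have "1 = cmod (f s) * cmod (g s)" using fg[of s] by (metis norm_mult norm_one)
      also have "\<dots> \<le> cmod (f s) * K" by (intro mult_left_mono gK) auto
      finally show ?thesis using K by (simp add: field_simps)
    qed
    then have "f \<in> exponentials"
      by (rule exponential_if_bounded_below[OF fB f'B]) (use K in simp)
    then obtain h where h: "h \<in> B" "\<And>s. f s = exp (h s)" by (auto simp: exponentials_def)
    have hD: "h \<in> deriv_algebra m B"
      by (rule logarithm_in_deriv_algebra[OF f g fg h])
    then show "f \<in> algebra_exp (deriv_algebra m B) (deriv_norm m nrm) ` deriv_algebra m B"
      by (intro image_eqI[OF _ hD]) (simp add: D.algebra_exp_eq h fun_eq_iff)
  next
    fix f assume "f \<in> algebra_exp (deriv_algebra m B) (deriv_norm m nrm) ` deriv_algebra m B"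
    then obtain a where a: "a \<in> deriv_algebra m B" "f = (\<lambda>s. exp (a s))"
      by (auto simp: D.algebra_exp_eq)
    have "(\<lambda>s. exp (- a s)) \<in> deriv_algebra m B"
      by (intro D.exp_series_limit D.uminus_closed a)
    moreover have "f s * exp (- a s) = 1" for s
      by (simp add: a exp_minus)
    ultimately show "f \<in> invertibles (deriv_algebra m B)"
      using D.exp_series_limit(1)[OF a(1)] a(2)
      unfolding invertibles_def by (intro CollectI conjI bexI[of _ "\<lambda>s. exp (- a s)"]) auto
  qed
qed

end
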